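(* Let $\Gamma$ be a reduct of $(\mathbb{Z};<)$ with finite relational signature. Then $\mathrm{CSP}(\Gamma)=\mathrm{CSP}(\Delta)$ for a structure $\Delta$ (with the same signature) that is one of the following: (1) a finite structure; (2) a reduct of $(\mathbb{Q};<)$; (3) a reduct of $(\mathbb{Z};<)$ in which the relation $\mathrm{Dist}_k=\{(x,y)\in\mathbb{Z}^2:|x-y|=k\}$ is primitive positive definable for every integer $k\ge1$; (4) a reduct of $(\mathbb{Z};<)$ in which $\mathrm{suc}=\{(x,y)\in\mathbb{Z}^2:y=x+1\}$ is primitive positive definable.
   Context: A reduct of a structure $D$ is a relational structure with the same domain whose relations are first-order definable in $D$. $\mathrm{CSP}(\Gamma)$ is the problem of deciding whether a given primitive positive sentence in the signature of $\Gamma$ holds in $\Gamma$; two structures with the same signature have equal CSPs if they satisfy the same primitive positive sentences. A relation is primitive positive (pp-)definable in $\Gamma$ if it is defined by a formula $\exists\bar x(\psi_1\wedge\dots\wedge\psi_m)$ with each $\psi_i$ atomic in the signature of $\Gamma$ or an equality. *)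

theory Defs
  imports Complex_Main
begin

datatype 's fm = Atom 's "nat list" | Eq nat nat | Neg "'s fm" | Conj "'s fm" "'s fm" | Ex nat "'s fm"

fun sat :: "'a set \<Rightarrow> ('s \<Rightarrow> 'a list set) \<Rightarrow> 's fm \<Rightarrow> (nat \<Rightarrow> 'a) \<Rightarrow> bool" where
  "sat D I (Atom s xs) v = (map v xs \<in> I s)"
| "sat D I (Eq x y) v = (v x = v y)"
| "sat D I (Neg p) v = (\<not> sat D I p v)"
| "sat D I (Conj p q) v = (sat D I p v \<and> sat D I q v)"
| "sat D I (Ex x p) v = (\<exists>a\<in>D. sat D I p (v(x := a)))"

fun fv :: "'s fm \<Rightarrow> nat set" where
  "fv (Atom s xs) = set xs"
| "fv (Eq x y) = {x, y}"
| "fv (Neg p) = fv p"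
| "fv (Conj p q) = fv p \<union> fv q"
| "fv (Ex x p) = fv p - {x}"

fun is_pp :: "'s fm \<Rightarrow> bool" where
  "is_pp (Atom s xs) = True"
| "is_pp (Eq x y) = True"
| "is_pp (Neg p) = False"
| "is_pp (Conj p q) = (is_pp p \<and> is_pp q)"
| "is_pp (Ex x p) = is_pp p"

fun wf_fm :: "('s \<Rightarrow> nat) \<Rightarrow> 's fm \<Rightarrow> bool" where
  "wf_fm ar (Atom s xs) = (length xs = ar s)"
| "wf_fm ar (Eq x y) = True"
| "wf_fm ar (Neg p) = wf_fm ar p"
| "wf_fm ar (Conj p q) = (wf_fm ar p \<and> wf_fm ar q)"
| "wf_fm ar (Ex x p) = wf_fm ar p"

definition wf_structure :: "('s \<Rightarrow> nat) \<Rightarrow> 'a set \<Rightarrow> ('s \<Rightarrow> 'a list set) \<Rightarrow> bool" where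
  "wf_structure ar D I \<longleftrightarrow> D \<noteq> {} \<and> (\<forall>s. I s \<subseteq> {xs. length xs = ar s \<and> set xs \<subseteq> D})"

definition holds :: "'a set \<Rightarrow> ('s \<Rightarrow> 'a list set) \<Rightarrow> 's fm \<Rightarrow> bool" where
  "holds D I p \<longleftrightarrow> (\<forall>v. range v \<subseteq> D \<longrightarrow> sat D I p v)"

definition pp_sentence :: "('s \<Rightarrow> nat) \<Rightarrow> 's fm \<Rightarrow> bool" where
  "pp_sentence ar p \<longleftrightarrow> is_pp p \<and> wf_fm ar p \<and> fv p = {}"

definition same_csp :: "('s \<Rightarrow> nat) \<Rightarrow> 'a set \<Rightarrow> ('s \<Rightarrow> 'a list set) \<Rightarrow> 'b set \<Rightarrow> ('s \<Rightarrow> 'b list set) \<Rightarrow> bool" where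
  "same_csp ar D1 I1 D2 I2 \<longleftrightarrow> (\<forall>p. pp_sentence ar p \<longrightarrow> (holds D1 I1 p \<longleftrightarrow> holds D2 I2 p))"

definition defined_by :: "'a set \<Rightarrow> ('s \<Rightarrow> 'a list set) \<Rightarrow> nat \<Rightarrow> 's fm \<Rightarrow> 'a list set" where
  "defined_by D I n p = {xs. length xs = n \<and> (\<exists>v. range v \<subseteq> D \<and> map v [0..<n] = xs \<and> sat D I p v)}"

definition fo_definable :: "'a set \<Rightarrow> ('s \<Rightarrow> 'a list set) \<Rightarrow> ('s \<Rightarrow> nat) \<Rightarrow> nat \<Rightarrow> 'a list set \<Rightarrow> bool" where
  "fo_definable D I ar n R \<longleftrightarrow> (\<exists>p. wf_fm ar p \<and> fv p \<subseteq> {..<n} \<and> R = defined_by D I n p)"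

definition pp_definable :: "'a set \<Rightarrow> ('s \<Rightarrow> 'a list set) \<Rightarrow> ('s \<Rightarrow> nat) \<Rightarrow> nat \<Rightarrow> 'a list set \<Rightarrow> bool" where
  "pp_definable D I ar n R \<longleftrightarrow> (\<exists>p. is_pp p \<and> wf_fm ar p \<and> fv p \<subseteq> {..<n} \<and> R = defined_by D I n p)"

definition lt_rel :: "unit \<Rightarrow> 'a::linorder list set" where
  "lt_rel = (\<lambda>_. {[x, y] | x y. x < y})"

definition lt_ar :: "unit \<Rightarrow> nat" where
  "lt_ar = (\<lambda>_. 2)"

definition order_reduct :: "('s \<Rightarrow> nat) \<Rightarrow> ('s \<Rightarrow> 'a::linorder list set) \<Rightarrow> bool" where
  "order_reduct ar J \<longleftrightarrow> (\<forall>s. fo_definable (UNIV :: 'a set) lt_rel lt_ar (ar s) (J s))"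

definition Dist :: "int \<Rightarrow> int list set" where
  "Dist k = {[x, y] | x y. \<bar>x - y\<bar> = k}"

definition suc_rel :: "int list set" where
  "suc_rel = {[x, y] | x y. y = x + 1}"

end

theory Submission
  imports Defs "HOL-Library.Nat_Bijection"
begin

text \<open>
  By quantifier elimination, a relation of \<open>\<Gamma>\<close> depends only on the differences of its entries,
  truncated at some threshold \<open>N\<close>. A primitive positive sentence is transferred by maps
  that preserve the relations on a finite set, so everything depends on the filter of maps of
  \<open>\<int>\<close> that preserve the relations of \<open>\<Gamma>\<close> on ever larger finite sets.

  Suppose first that all distances \<open>d \<ge> 1\<close> can be stretched without bound. If pairs of far points
  can be merged, then finite sets can be mapped to a point. Otherwise they can be mapped so
  that distinct images are more than \<open>N\<close> apart, and \<open>\<Gamma>\<close> has the CSP of a reduct of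
  \<open>(\<rat>; <)\<close>. Now suppose that some distance is bounded; then some \<open>t \<ge> 1\<close> can be stretched to
  at most \<open>t\<close> (call it tight). If a tight distance can be shrunk irreversibly, then iterated
  shrinking gives images of bounded size. Otherwise all tight distances are preserved exactly; they
  are multiples of the least one, \<open>g\<close>, and every pair can be moved to a distance that is a
  multiple of \<open>g\<close>. So \<open>\<Gamma>\<close> has the CSP of its restriction to \<open>g\<int>\<close>, on which all
  distances are preserved, and the diagrams of finite substructures define \<open>Dist\<^sub>k\<close> for all
  \<open>k\<close>, or \<open>suc\<close> if \<open>x \<mapsto> -x\<close> does not preserve the relations.
\<close>

section \<open>Gaps and zigzags in the integers\<close>

text \<open>No map on all of \<open>int\<close> is ever constructed: a primitive positive sentence
  sees only finitely many witnesses, so one suitable map for each finite set is enough. Goals are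
  imposed on a finite set pair by pair, by composing such maps. The obstacle is that a later map may
  undo what an earlier one achieved. Hence goals are phrased so that images inherit them: being
  merged, being unable to return to distance \<open>k\<close>, being congruent modulo
  \<open>g\<close> (inherited because multiples of \<open>g\<close> are frozen). Being far apart is
  not inherited, which is why spreading points needs a maximal family of separated pairs and spare
  copies of clusters. The number \<open>g\<close> comes from Euclid's subtraction applied to tight
  distances. Only its multiples are known to be frozen, so restricting to them is what makes
  distance 1 rigid in the new structure.\<close>

definition capeq :: "int \<Rightarrow> int \<Rightarrow> int \<Rightarrow> bool" where
  "capeq N a b \<longleftrightarrow> a = b \<or> (N < a \<and> N < b) \<or> (a < - N \<and> b < - N)"

text \<open>If all steps follow the direction of the first, the total is at least
  \<open>n * d + c\<close>, as the first step has full length. Otherwise some step of length at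
  least \<open>d\<close> goes back and the other \<open>n - 1\<close> contribute at most
  \<open>d + c\<close> each. For \<open>d\<close> large compared with \<open>n * c\<close> this
  leaves a forbidden zone between the two outcomes.\<close>

lemma zigzag:
  fixes a :: "nat \<Rightarrow> int" and d c :: int
  assumes "0 \<le> c" "0 < d" and first: "\<bar>a 1 - a 0\<bar> = d + c"
    and step: "\<And>j. j < n \<Longrightarrow> d \<le> \<bar>a (Suc j) - a j\<bar> \<and> \<bar>a (Suc j) - a j\<bar> \<le> d + c"
    and n: "1 \<le> n"
  shows "\<bar>a n - a 0\<bar> \<ge> int n * d + c \<or> \<bar>a n - a 0\<bar> \<le> (int n - 2) * d + (int n - 1) * c"
proof -
  define s where "s = sgn (a 1 - a 0)"
  define b where "b j = s * (a j - a 0)" for j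
  have s: "s = 1 \<or> s = -1" using first assms unfolding s_def by (auto simp: sgn_if)
  have b_diff: "\<bar>b i - b j\<bar> = \<bar>a i - a j\<bar>" for i j using s unfolding b_def by auto
  have b0: "b 0 = 0" unfolding b_def by simp
  have b1: "b 1 = d + c" using first assms unfolding b_def s_def by (auto simp: sgn_if)
  \<comment> \<open>The upper bound added to the first alternative is needed at the step where the
    sequence first turns back.\<close>
  have "(int n * d + c \<le> b n \<and> b n \<le> int n * (d + c)) \<or> \<bar>b n\<bar> \<le> (int n - 2) * d + (int n - 1) * c"
    using n step
  proof (induction n rule: nat_induct_at_least)
    case base then show ?case using b1 by simp
  next
    case (Suc n)
    have IH: "(int n * d + c \<le> b n \<and> b n \<le> int n * (d + c)) \<or> \<bar>b n\<bar> \<le> (int n - 2) * d + (int n - 1) * c"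
      using Suc by simp
    have st: "d \<le> \<bar>b (Suc n) - b n\<bar>" "\<bar>b (Suc n) - b n\<bar> \<le> d + c" using Suc.prems b_diff by simp_all
    have nd: "int n * d \<ge> d" using Suc.hyps assms by (simp add: mult_le_cancel_right1)
    have nc: "int n * c \<ge> 0" using assms by simp
    from IH show ?case
    proof
      assume h: "int n * d + c \<le> b n \<and> b n \<le> int n * (d + c)"
      show ?thesis
      proof (cases "b (Suc n) \<ge> b n")
        case True then show ?thesis using h st by (auto simp: algebra_simps)
      next
        case False
        then have "b (Suc n) \<le> int n * (d + c) - d" "b (Suc n) \<ge> int n * d + c - (d + c)" using h st by linarith+
        then show ?thesis using nd nc by (auto simp: algebra_simps)
      qed
    next
      assume "\<bar>b n\<bar> \<le> (int n - 2) * d + (int n - 1) * c"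
      then show ?thesis using st by (auto simp: algebra_simps)
    qed
  qed
  moreover have "\<bar>b n\<bar> = \<bar>a n - a 0\<bar>" using b_diff[of n 0] b0 by simp
  ultimately show ?thesis by linarith
qed

lemma int_cover:
  fixes X :: "int set" and N :: int
  assumes "finite X" "0 \<le> N"
  shows "finite (\<Union>y\<in>X. {y..y + N})" "int (card (\<Union>y\<in>X. {y..y + N})) \<le> int (card X) * (N + 1)"
proof -
  show "finite (\<Union>y\<in>X. {y..y + N})" using assms by auto
  have "card (\<Union>y\<in>X. {y..y + N}) \<le> (\<Sum>y\<in>X. card {y..y + N})" by (rule card_UN_le[OF assms(1)])
  also have "\<dots> = card X * nat (N + 1)" by simp
  finally show "int (card (\<Union>y\<in>X. {y..y + N})) \<le> int (card X) * (N + 1)"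
    using assms(2) by (metis (no_types) int_nat_eq of_nat_le_iff of_nat_mult add_nonneg_nonneg zero_le_one)
qed

text \<open>Counting: the windows \<open>{p..p + N}\<close> are too few to cover
  \<open>{u..<v}\<close>. At an uncovered \<open>z\<close> the set can be cut, since all differences
  across \<open>z\<close> exceed \<open>N\<close>.\<close>

lemma exists_gap:
  fixes X :: "int set" and N :: int
  assumes "finite X" "0 \<le> N" "v - u > int (card X) * (N + 1)"
  shows "\<exists>z. u \<le> z \<and> z < v \<and> (\<forall>p\<in>X. p \<le> z \<longrightarrow> p + N < z)"
proof (rule ccontr)
  assume "\<not> ?thesis"
  then have "{u..<v} \<subseteq> (\<Union>y\<in>X. {y..y + N})" by force
  then have "card {u..<v} \<le> card (\<Union>y\<in>X. {y..y + N})" using int_cover[OF assms(1,2)] by (intro card_mono)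
  then show False using int_cover(2)[OF assms(1,2)] assms(3) by simp
qed

text \<open>Keep the window \<open>{y..y + N}\<close> of each point and delete all other integers;
  \<open>g\<close> is the position after deletion. Differences up to \<open>N\<close> lie inside a
  window and survive, larger ones retain at least \<open>N + 1\<close> positions.\<close>

lemma compress:
  fixes X :: "int set" and N :: int
  assumes "finite X" "0 \<le> N"
  shows "\<exists>g. (\<forall>x\<in>X. \<forall>y\<in>X. capeq N (x - y) (g x - g y)) \<and> g ` X \<subseteq> {0..int (card X) * (N + 1)}"
proof -
  define U where "U = (\<Union>y\<in>X. {y..y + N})"
  define g where "g x = int (card ({..<x} \<inter> U))" for x
  have U: "finite U" "int (card U) \<le> int (card X) * (N + 1)" unfolding U_def using int_cover[OF assms] by auto
  have diff: "g y - g x = int (card ({x..<y} \<inter> U))" if "x \<le> y" for x y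
  proof -
    have "{..<y} \<inter> U = ({..<x} \<inter> U) \<union> ({x..<y} \<inter> U)" using that by auto
    moreover have "({..<x} \<inter> U) \<inter> ({x..<y} \<inter> U) = {}" by auto
    ultimately have "card ({..<y} \<inter> U) = card ({..<x} \<inter> U) + card ({x..<y} \<inter> U)"
      using U(1) by (metis card_Un_disjoint finite_Int)
    then show ?thesis unfolding g_def by simp
  qed
  have key: "g y - g x = y - x \<or> (N < y - x \<and> N < g y - g x)" if "x \<in> X" "x \<le> y" for x y
  proof (cases "y - x \<le> N")
    case True
    then have "{x..<y} \<inter> U = {x..<y}" unfolding U_def using that by fastforce
    then show ?thesis using diff[OF that(2)] that(2) by simp
  next
    case False
    have *: "{x..<x + N + 1} \<subseteq> {x..<y} \<inter> U" unfolding U_def using that False by fastforce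
    have "card {x..<x + N + 1} \<le> card ({x..<y} \<inter> U)" by (rule card_mono[OF _ *]) (use U in auto)
    then have "N + 1 \<le> int (card ({x..<y} \<inter> U))" by (simp add: nat_le_iff)
    then show ?thesis using False diff[OF that(2)] by simp
  qed
  have "capeq N (x - y) (g x - g y)" if "x \<in> X" "y \<in> X" for x y
    using key[of x y] key[of y x] that unfolding capeq_def by (cases "x \<le> y") auto
  moreover have "g x \<in> {0..int (card X) * (N + 1)}" for x
  proof -
    have "card ({..<x} \<inter> U) \<le> card U" using U by (intro card_mono) auto
    then show ?thesis using U unfolding g_def by simp
  qed
  ultimately show ?thesis by blast
qed

section \<open>The filter of partial homomorphisms\<close>

text \<open>Abstracts preservation of the relations of \<Gamma> on a finite set: the combinatorics
  needs only these closure properties. Quantifier elimination enters through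
  \<open>hom_capeq\<close>, which permits translations and also moving pieces more than
  \<open>N\<close> apart, as long as they stay so in the same order.\<close>

locale partial_homs =
  fixes hom :: "int set \<Rightarrow> (int \<Rightarrow> int) \<Rightarrow> bool" and N :: int
  assumes N_nonneg: "0 \<le> N"
    and hom_id: "hom S (\<lambda>x. x)"
    and hom_mono: "hom S h \<Longrightarrow> T \<subseteq> S \<Longrightarrow> hom T h"
    and hom_comp: "hom S h \<Longrightarrow> hom (h ` S) g \<Longrightarrow> hom S (\<lambda>x. g (h x))"
    and hom_capeq: "hom S h \<Longrightarrow> (\<And>x y. x \<in> S \<Longrightarrow> y \<in> S \<Longrightarrow> capeq N (h x - h y) (h' x - h' y))
          \<Longrightarrow> hom S h'"
begin

text \<open>Under this filter \<open>eventually\<close> means "forced by preserving some finite set"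
  and \<open>frequently\<close> means "achievable on every finite set".\<close>

definition homs :: "(int \<Rightarrow> int) filter" where
  "homs = (INF S\<in>Collect finite. principal {h. hom S h})"

lemma eventually_homs: "eventually P homs \<longleftrightarrow> (\<exists>S. finite S \<and> (\<forall>h. hom S h \<longrightarrow> P h))"
  unfolding homs_def
  by (subst eventually_INF_base)
     (auto simp: eventually_principal intro: exI[of _ "_ \<union> _"] hom_mono
       intro!: bexI[of _ "_ \<union> _"])

lemma frequently_homs: "frequently P homs \<longleftrightarrow> (\<forall>S. finite S \<longrightarrow> (\<exists>h. hom S h \<and> P h))"
  unfolding frequently_def eventually_homs by blast

lemma frequently_homsE:
  assumes "frequently P homs" "finite S" obtains h where "hom S h" "P h"
  using assms unfolding frequently_homs by blast

lemma frequently_id: "P (\<lambda>x. x) \<Longrightarrow> frequently P homs"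
  unfolding frequently_homs using hom_id by blast

lemma eventually_comp:
  assumes "\<forall>\<^sub>F h in homs. P h"
  shows "\<forall>\<^sub>F h in homs. \<forall>\<^sub>F g in homs. P (\<lambda>x. g (h x))"
proof -
  from assms obtain S where S: "finite S" "\<And>h. hom S h \<Longrightarrow> P h"
    unfolding eventually_homs by blast
  have "\<forall>\<^sub>F g in homs. P (\<lambda>x. g (h x))" if "hom S h" for h
    unfolding eventually_homs using S that hom_comp by (intro exI[of _ "h ` S"]) auto
  then show ?thesis
    using S(1) eventually_homs[of "\<lambda>h. \<forall>\<^sub>F g in homs. P (\<lambda>x. g (h x))"] by blast
qed

text \<open>The tool for improving maps step by step: a goal that can be met after a suitable first
  map can be met outright.\<close>

lemma frequently_comp:
  assumes "\<exists>\<^sub>F h in homs. \<exists>\<^sub>F g in homs. P (\<lambda>x. g (h x))"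
  shows "\<exists>\<^sub>F h in homs. P h"
  using assms eventually_comp[of "\<lambda>h. \<not> P h"] unfolding frequently_def by auto

lemma eventually_shift:
  assumes "\<forall>\<^sub>F h in homs. P h"
  shows "\<forall>\<^sub>F h in homs. P (\<lambda>x. h (x + a))"
proof -
  from assms obtain S where S: "finite S" "\<And>h. hom S h \<Longrightarrow> P h"
    unfolding eventually_homs by blast
  have "P (\<lambda>x. h (x + a))" if "hom ((\<lambda>x. x + a) ` S) h" for h
    by (rule S(2), rule hom_comp[OF _ that], rule hom_capeq[OF hom_id]) (auto simp: capeq_def)
  then show ?thesis using S(1) unfolding eventually_homs by blast
qed

lemma eventually_pair:
  assumes "\<forall>\<^sub>F h in homs. P \<bar>h d - h 0\<bar>" "\<bar>x - y\<bar> = \<bar>d\<bar>"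
  shows "\<forall>\<^sub>F h in homs. P \<bar>h x - h y\<bar>"
proof -
  consider "x = y + d" | "y = x + d" using assms(2) by linarith
  then show ?thesis
  proof cases
    case 1 then show ?thesis using eventually_shift[OF assms(1), of y] by (simp add: add.commute)
  next
    case 2 then show ?thesis using eventually_shift[OF assms(1), of x]
      by (simp add: add.commute abs_minus_commute)
  qed
qed

lemma frequently_pair:
  assumes "\<exists>\<^sub>F h in homs. P \<bar>h d - h 0\<bar>" "\<bar>x - y\<bar> = \<bar>d\<bar>"
  shows "\<exists>\<^sub>F h in homs. P \<bar>h x - h y\<bar>"
proof -
  have "\<forall>\<^sub>F h in homs. \<not> P \<bar>h d - h 0\<bar>" if *: "\<forall>\<^sub>F h in homs. \<not> P \<bar>h x - h y\<bar>"
  proof -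
    have 1: "\<forall>\<^sub>F h in homs. \<not> P \<bar>h (x - y) - h 0\<bar>"
      using eventually_shift[OF *, of "- y"] by simp
    show ?thesis by (rule eventually_pair[of "\<lambda>z. \<not> P z", OF 1]) (use assms(2) in auto)
  qed
  then show ?thesis using assms(1) unfolding frequently_def by auto
qed

text \<open>By invariance under translation and symmetry of the distance, the pair \<open>(0, d)\<close> stands for
  all pairs at distance \<open>d\<close>.\<close>

definition reach :: "int \<Rightarrow> int \<Rightarrow> bool" where
  "reach d d' \<longleftrightarrow> (\<exists>\<^sub>F h in homs. \<bar>h d - h 0\<bar> = d')"

definition bnd :: "int \<Rightarrow> bool" where
  "bnd d \<longleftrightarrow> (\<exists>L. \<forall>\<^sub>F h in homs. \<bar>h d - h 0\<bar> \<le> L)"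

lemma reach_refl: "0 \<le> d \<Longrightarrow> reach d d"
  unfolding reach_def by (rule frequently_id) simp

lemma frequently_trans:
  assumes "reach d d'" "\<exists>\<^sub>F h in homs. P \<bar>h d' - h 0\<bar>"
  shows "\<exists>\<^sub>F h in homs. P \<bar>h d - h 0\<bar>"
proof (rule frequently_comp)
  show "\<exists>\<^sub>F h in homs. \<exists>\<^sub>F g in homs. P \<bar>g (h d) - g (h 0)\<bar>"
    using assms(1) unfolding reach_def
    by (rule frequently_elim1) (rule frequently_pair[OF assms(2)], simp)
qed

lemma reach_trans: "reach d d' \<Longrightarrow> reach d' d'' \<Longrightarrow> reach d d''"
  using frequently_trans[of d d' "\<lambda>z. z = d''"] unfolding reach_def by blast

lemma eventually_trans:
  assumes "reach d d'" "\<forall>\<^sub>F h in homs. P \<bar>h d - h 0\<bar>"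
  shows "\<forall>\<^sub>F h in homs. P \<bar>h d' - h 0\<bar>"
  using frequently_trans[OF assms(1), of "\<lambda>z. \<not> P z"] assms(2) unfolding frequently_def by auto

lemma bnd_trans: "reach d d' \<Longrightarrow> bnd d \<Longrightarrow> bnd d'"
  unfolding bnd_def using eventually_trans[where P="\<lambda>z. z \<le> _"] by blast

lemma frequently_reach: "reach \<bar>x - y\<bar> k \<Longrightarrow> \<exists>\<^sub>F h in homs. \<bar>h x - h y\<bar> = k"
  unfolding reach_def by (rule frequently_pair[where P="\<lambda>z. z = k" and d="\<bar>x - y\<bar>"]) auto

text \<open>If the image pair could return to \<open>k\<close>, composition would bring the original
  pair to \<open>k\<close>. This is what makes irreversibility survive later maps.\<close>

lemma not_reach_persistent:
  assumes "\<not> reach \<bar>x - y\<bar> k"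
  shows "\<forall>\<^sub>F h in homs. \<not> reach \<bar>h x - h y\<bar> k"
proof (rule ccontr)
  assume "\<not> ?thesis"
  then have "\<exists>\<^sub>F h in homs. reach \<bar>h x - h y\<bar> k" by (simp add: frequently_def)
  then have "\<exists>\<^sub>F h in homs. \<exists>\<^sub>F g in homs. \<bar>g (h x) - g (h y)\<bar> = k"
    by (rule frequently_elim1) (rule frequently_reach)
  then have "\<exists>\<^sub>F h in homs. \<bar>h x - h y\<bar> = k" by (rule frequently_comp)
  then have "\<exists>\<^sub>F h in homs. \<bar>h \<bar>x - y\<bar> - h 0\<bar> = k"
  proof -
    assume *: "\<exists>\<^sub>F h in homs. \<bar>h x - h y\<bar> = k"
    show ?thesis
    proof (rule ccontr)
      assume "\<not> ?thesis"
      then have "\<forall>\<^sub>F h in homs. \<bar>h \<bar>x - y\<bar> - h 0\<bar> \<noteq> k" by (simp add: frequently_def)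
      from eventually_pair[where P="\<lambda>z. z \<noteq> k", OF this, of x y] * show False by (simp add: frequently_def)
    qed
  qed
  with assms show False by (simp add: reach_def)
qed

text \<open>Pigeonhole: a bounded distance has finitely many possible values, so a single value
  satisfying \<open>P\<close> is achievable on every finite set.\<close>

lemma reach_of_frequently:
  assumes "\<exists>\<^sub>F h in homs. P \<bar>h d - h 0\<bar>" "bnd d"
  shows "\<exists>d'. reach d d' \<and> P d' \<and> 0 \<le> d'"
proof -
  obtain L where L: "\<forall>\<^sub>F h in homs. \<bar>h d - h 0\<bar> \<le> L" using assms(2) bnd_def by blast
  have "\<exists>\<^sub>F h in homs. \<exists>d'\<in>{0..L}. \<bar>h d - h 0\<bar> = d' \<and> P d'"
    by (rule frequently_mp[OF _ assms(1)], rule eventually_mono[OF L]) auto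
  then have "\<exists>d'\<in>{0..L}. \<exists>\<^sub>F h in homs. \<bar>h d - h 0\<bar> = d' \<and> P d'"
    by (subst (asm) frequently_bex_finite_distrib) auto
  then obtain d' where d': "0 \<le> d'" "\<exists>\<^sub>F h in homs. \<bar>h d - h 0\<bar> = d' \<and> P d'" by auto
  have "reach d d'" unfolding reach_def by (rule frequently_elim1[OF d'(2)]) simp
  moreover have "P d'" using frequently_ex[OF d'(2)] by simp
  ultimately show ?thesis using d'(1) by blast
qed

lemma eventually_reach:
  assumes "bnd d" "\<And>d'. reach d d' \<Longrightarrow> 0 \<le> d' \<Longrightarrow> P d'"
  shows "\<forall>\<^sub>F h in homs. P \<bar>h d - h 0\<bar>"
  using reach_of_frequently[of "\<lambda>z. \<not> P z" d] assms unfolding frequently_def by auto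

text \<open>Walk from \<open>0\<close> to \<open>a - b\<close> through \<open>a\<close>. The bounded
  distances thus form a subgroup of the integers.\<close>

lemma bnd_diff:
  assumes "bnd a" "bnd b" shows "bnd (a - b)"
proof -
  obtain L M where L: "\<forall>\<^sub>F h in homs. \<bar>h a - h 0\<bar> \<le> L" and M: "\<forall>\<^sub>F h in homs. \<bar>h b - h 0\<bar> \<le> M"
    using assms bnd_def by blast
  have "\<forall>\<^sub>F h in homs. \<bar>h a - h (a - b)\<bar> \<le> M" by (rule eventually_pair[OF M]) simp
  with L have "\<forall>\<^sub>F h in homs. \<bar>h (a - b) - h 0\<bar> \<le> L + M" by eventually_elim linarith
  then show ?thesis unfolding bnd_def by blast
qed

lemma bnd_0: "bnd 0" unfolding bnd_def by (auto intro: exI[of _ 0])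
lemma bnd_add: "bnd a \<Longrightarrow> bnd b \<Longrightarrow> bnd (a + b)"
  using bnd_diff[of a "0 - b"] bnd_diff[of 0 b] bnd_0 by simp
lemma bnd_abs: "bnd \<bar>a\<bar> \<longleftrightarrow> bnd a"
  using bnd_diff[of 0 a] bnd_diff[of 0 "-a"] bnd_0 by (auto simp: abs_if)

subsection \<open>Tight distances\<close>

definition tight :: "int \<Rightarrow> bool" where
  "tight t \<longleftrightarrow> 1 \<le> t \<and> (\<forall>\<^sub>F h in homs. \<bar>h t - h 0\<bar> \<le> t)"

lemma tight_bnd: "tight t \<Longrightarrow> bnd t"
  unfolding tight_def bnd_def by blast

lemma eventually_le_add:
  assumes "\<forall>\<^sub>F h in homs. \<bar>h s - h 0\<bar> \<le> a" "\<forall>\<^sub>F h in homs. \<bar>h t - h 0\<bar> \<le> b"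
  shows "\<forall>\<^sub>F h in homs. \<bar>h (s + t) - h 0\<bar> \<le> a + b"
proof -
  have "\<forall>\<^sub>F h in homs. \<bar>h (s + t) - h s\<bar> \<le> b"
    by (rule eventually_pair[OF assms(2)]) simp
  with assms(1) show ?thesis by eventually_elim linarith
qed

lemma tight_add: "tight s \<Longrightarrow> tight t \<Longrightarrow> tight (s + t)"
  unfolding tight_def using eventually_le_add by auto

lemma tight_mult:
  assumes "tight t" "1 \<le> m"
  shows "tight (m * t)"
  using assms(2)
proof (induction m rule: int_ge_induct)
  case base then show ?case using assms(1) by simp
next
  case (step i) then show ?case using tight_add[OF _ assms(1), of "i * t"] by (simp add: algebra_simps)
qed

lemma tight_mult_le:
  assumes "tight t" "0 \<le> m"
  shows "\<forall>\<^sub>F h in homs. \<bar>h (m * t) - h 0\<bar> \<le> m * t"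
proof (cases "m = 0")
  case False
  then have "tight (m * t)" using assms tight_mult by simp
  then show ?thesis unfolding tight_def by blast
qed simp

lemma tight_bnd_mult: "tight t \<Longrightarrow> bnd (m * t)"
  using tight_mult_le[of t "\<bar>m\<bar>"] bnd_abs[of "m * t"]
  unfolding bnd_def tight_def by (auto simp: abs_mult)

text \<open>Split \<open>d\<close> into a multiple of \<open>t\<close>, which does not stretch, and
  one of \<open>t\<close> residues; \<open>C\<close> adds up bounds for the residues. The point is
  that \<open>C\<close> is uniform in \<open>d\<close>, although the finite set that forces the
  bound may depend on \<open>d\<close>.\<close>

lemma tight_lipschitz:
  assumes "tight t"
  shows "\<exists>C\<ge>0. \<forall>d\<ge>0. bnd d \<longrightarrow> (\<forall>\<^sub>F h in homs. \<bar>h d - h 0\<bar> \<le> d + C)"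
proof -
  have t: "1 \<le> t" using assms tight_def by simp
  have "\<forall>r. \<exists>c. 0 \<le> c \<and> (bnd r \<longrightarrow> (\<forall>\<^sub>F h in homs. \<bar>h r - h 0\<bar> \<le> c))"
  proof
    fix r show "\<exists>c. 0 \<le> c \<and> (bnd r \<longrightarrow> (\<forall>\<^sub>F h in homs. \<bar>h r - h 0\<bar> \<le> c))"
    proof (cases "bnd r")
      case True
      then obtain L where "\<forall>\<^sub>F h in homs. \<bar>h r - h 0\<bar> \<le> L" unfolding bnd_def by blast
      then have "\<forall>\<^sub>F h in homs. \<bar>h r - h 0\<bar> \<le> \<bar>L\<bar>" by eventually_elim linarith
      then show ?thesis by (intro exI[of _ "\<bar>L\<bar>"]) auto
    qed auto
  qed
  from choice[OF this] obtain c where c0: "\<And>r. 0 \<le> c r"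
    and c: "\<And>r. bnd r \<Longrightarrow> \<forall>\<^sub>F h in homs. \<bar>h r - h 0\<bar> \<le> c r" by blast
  define C where "C = (\<Sum>r\<in>{0..<t}. c r)"
  have "\<forall>\<^sub>F h in homs. \<bar>h d - h 0\<bar> \<le> d + C" if "0 \<le> d" "bnd d" for d
  proof -
    have eq: "d div t * t + d mod t = d" by simp
    have r: "0 \<le> d mod t" "d mod t < t" using t by auto
    have "bnd (d mod t)"
      using bnd_diff[OF that(2) tight_bnd_mult[OF assms, of "d div t"]] by (simp add: minus_div_mult_eq_mod)
    moreover have "0 \<le> d div t" using that t by (simp add: pos_imp_zdiv_nonneg_iff)
    ultimately have "\<forall>\<^sub>F h in homs. \<bar>h d - h 0\<bar> \<le> d div t * t + c (d mod t)"
      using eventually_le_add[OF tight_mult_le[OF assms, of "d div t"] c[of "d mod t"]]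
      unfolding eq by blast
    moreover have "c (d mod t) \<le> C" unfolding C_def
      by (rule member_le_sum) (use r c0 in auto)
    moreover have "d div t * t \<le> d" using eq r by linarith
    ultimately show ?thesis by (auto elim!: eventually_mono)
  qed
  moreover have "0 \<le> C" unfolding C_def by (simp add: c0 sum_nonneg)
  ultimately show ?thesis by blast
qed

section \<open>Irreversible shrinking of a tight distance\<close>

text \<open>Steps are treated one at a time: a step that can still reach \<open>k\<close> can be
  moved on to \<open>d\<close>, from where there is no return, and steps already treated stay so by
  \<open>not_reach_persistent\<close>. The value \<open>d\<close> itself need not persist, which is
  why the conclusion speaks of unreachability.\<close>

lemma shrink_all:
  assumes "tight k" "reach k d" "\<not> reach d k" "finite A"
  shows "\<exists>\<^sub>F h in homs. \<forall>a\<in>A. \<not> reach \<bar>h (a + k) - h a\<bar> k"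
  using assms(4)
proof (induction A)
  case empty then show ?case by (auto intro: frequently_id)
next
  case (insert a A)
  let ?P = "\<lambda>h a. \<not> reach \<bar>h (a + k) - h a\<bar> k"
  have "\<exists>\<^sub>F g in homs. \<forall>b\<in>insert a A. ?P (\<lambda>x. g (h x)) b" if h: "\<forall>b\<in>A. ?P h b" for h
  proof -
    have "\<forall>\<^sub>F g in homs. \<forall>b\<in>A. ?P (\<lambda>x. g (h x)) b"
      using h insert.hyps(1) by (intro eventually_ball_finite) (auto intro: not_reach_persistent)
    from frequently_eventually_conj[OF _ this]
    have "\<exists>\<^sub>F g in homs. (\<forall>b\<in>A. ?P (\<lambda>x. g (h x)) b) \<and> ?P (\<lambda>x. g (h x)) a"
      if "\<exists>\<^sub>F g in homs. ?P (\<lambda>x. g (h x)) a"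
      using that by blast
    moreover have "\<exists>\<^sub>F g in homs. ?P (\<lambda>x. g (h x)) a"
    proof (cases "reach \<bar>h (a + k) - h a\<bar> k")
      case True
      then have "reach \<bar>h (a + k) - h a\<bar> d" using assms(2) reach_trans by blast
      then have "\<exists>\<^sub>F g in homs. \<bar>g (h (a + k)) - g (h a)\<bar> = d" by (rule frequently_reach)
      then show ?thesis by (rule frequently_elim1) (use assms(3) in auto)
    next
      case False then show ?thesis by (intro frequently_id) simp
    qed
    ultimately show ?thesis by (auto elim: frequently_elim1)
  qed
  note step = this
  show ?case
  proof (rule frequently_comp)
    from insert.IH
    show "\<exists>\<^sub>F h in homs. \<exists>\<^sub>F g in homs. \<forall>b\<in>insert a A. ?P (\<lambda>x. g (h x)) b"
    proof (rule frequently_elim1)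
      fix h assume "\<forall>b\<in>A. ?P h b"
      then show "\<exists>\<^sub>F g in homs. \<forall>b\<in>insert a A. ?P (\<lambda>x. g (h x)) b" by (rule step)
    qed
  qed
qed

text \<open>Tightness bounds each image by \<open>k\<close>, and the value \<open>k\<close> itself
  is excluded because \<open>k\<close> reaches \<open>k\<close>; so at least 1 is lost per
  step.\<close>

lemma shrink_steps:
  assumes "tight k" "reach k d" "\<not> reach d k" "finite A"
  shows "\<exists>\<^sub>F h in homs. \<forall>a\<in>A. \<bar>h (a + k) - h a\<bar> \<le> k - 1"
proof -
  have "\<forall>\<^sub>F h in homs. \<forall>a\<in>A. \<bar>h (a + k) - h a\<bar> \<le> k"
  proof (rule eventually_ball_finite[OF assms(4)], intro ballI)
    fix a
    have "\<forall>\<^sub>F h in homs. \<bar>h k - h 0\<bar> \<le> k" using assms(1) tight_def by blast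
    then show "\<forall>\<^sub>F h in homs. \<bar>h (a + k) - h a\<bar> \<le> k" by (rule eventually_pair) simp
  qed
  moreover have "reach k k" using assms(1) by (intro reach_refl) (simp add: tight_def)
  ultimately show ?thesis
    by (intro frequently_rev_mp[OF shrink_all[OF assms]])
       (elim eventually_mono, intro impI ballI, smt (verit))
qed

lemma telescope_le:
  fixes h :: "int \<Rightarrow> int"
  assumes "\<And>i. i < q \<Longrightarrow> \<bar>h (y + int i * k + k) - h (y + int i * k)\<bar> \<le> c"
  shows "\<bar>h (y + int q * k) - h y\<bar> \<le> int q * c"
  using assms
proof (induction q)
  case (Suc q)
  have "\<bar>h (y + int q * k) - h y\<bar> \<le> int q * c" using Suc by simp
  moreover have "\<bar>h (y + int q * k + k) - h (y + int q * k)\<bar> \<le> c" using Suc by simp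
  moreover have eq: "y + int (Suc q) * k = y + int q * k + k" "int (Suc q) * c = int q * c + c"
    by (simp_all add: algebra_simps)
  ultimately show ?case unfolding eq by linarith
qed simp

text \<open>Cut the segment from \<open>x\<close> to \<open>y\<close> into steps of length
  \<open>k\<close>, each of which loses at least 1, and a remainder shorter than \<open>k\<close>,
  controlled by the Lipschitz constant. The loss is proportional to the distance while
  \<open>C\<close> is uniform, so long distances really shrink.\<close>

lemma shrink_pairs:
  assumes "tight k" "reach k d" "\<not> reach d k"
  shows "\<exists>C\<ge>0. \<forall>P. finite P \<longrightarrow> (\<forall>(x, y)\<in>P. bnd (x - y)) \<longrightarrow>
    (\<exists>\<^sub>F h in homs. \<forall>(x, y)\<in>P. \<bar>h x - h y\<bar> \<le> (k - 1) * (\<bar>x - y\<bar> div k) + C)"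
proof -
  have k: "1 \<le> k" using assms(1) tight_def by simp
  obtain C where C: "C \<ge> 0" "\<And>d. d \<ge> 0 \<Longrightarrow> bnd d \<Longrightarrow> \<forall>\<^sub>F h in homs. \<bar>h d - h 0\<bar> \<le> d + C"
    using tight_lipschitz[OF assms(1)] by blast
  have "\<exists>\<^sub>F h in homs. \<forall>(x, y)\<in>P. \<bar>h x - h y\<bar> \<le> (k - 1) * (\<bar>x - y\<bar> div k) + (k + C)"
    if P: "finite P" "\<forall>(x, y)\<in>P. bnd (x - y)" for P
  proof -
    define q where "q x y = nat (\<bar>x - y\<bar> div k)" for x y
    define A where "A = (\<Union>(x, y)\<in>P. (\<lambda>i. min x y + int i * k) ` {..<q x y})"
    have "finite A" unfolding A_def using P(1) by auto
    then have "\<exists>\<^sub>F h in homs. \<forall>a\<in>A. \<bar>h (a + k) - h a\<bar> \<le> k - 1"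
      by (rule shrink_steps[OF assms])
    moreover have "\<forall>\<^sub>F h in homs. \<forall>p\<in>P. case p of (x, y) \<Rightarrow>
       \<bar>h (max x y) - h (min x y + int (q x y) * k)\<bar> \<le> k + C"
    proof (rule eventually_ball_finite[OF P(1)], clarify)
      fix x y assume "(x, y) \<in> P"
      then have b: "bnd \<bar>x - y\<bar>" using P(2) bnd_abs by auto
      have q: "int (q x y) = \<bar>x - y\<bar> div k" unfolding q_def using k
        by (simp add: pos_imp_zdiv_nonneg_iff)
      have "bnd (\<bar>x - y\<bar> mod k)"
        using bnd_diff[OF b tight_bnd_mult[OF assms(1), of "\<bar>x - y\<bar> div k"]]
        by (simp add: minus_div_mult_eq_mod)
      then have "\<forall>\<^sub>F h in homs. \<bar>h (\<bar>x - y\<bar> mod k) - h 0\<bar> \<le> \<bar>x - y\<bar> mod k + C"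
        using C(2) k by simp
      then have "\<forall>\<^sub>F h in homs. \<bar>h (max x y) - h (min x y + int (q x y) * k)\<bar> \<le> \<bar>x - y\<bar> mod k + C"
      proof (rule eventually_pair)
        have "max x y - min x y = \<bar>x - y\<bar>" by auto
        then show "\<bar>max x y - (min x y + int (q x y) * k)\<bar> = \<bar>\<bar>x - y\<bar> mod k\<bar>"
          using minus_div_mult_eq_mod[of "\<bar>x - y\<bar>" k] unfolding q by linarith
      qed
      moreover have "\<bar>x - y\<bar> mod k < k" by (rule pos_mod_bound) (use k in simp)
      ultimately show "\<forall>\<^sub>F h in homs. \<bar>h (max x y) - h (min x y + int (q x y) * k)\<bar> \<le> k + C"
        by (auto elim!: eventually_mono)
    qed
    ultimately have "\<exists>\<^sub>F h in homs. (\<forall>a\<in>A. \<bar>h (a + k) - h a\<bar> \<le> k - 1) \<and>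
       (\<forall>p\<in>P. case p of (x, y) \<Rightarrow> \<bar>h (max x y) - h (min x y + int (q x y) * k)\<bar> \<le> k + C)"
      by (rule frequently_eventually_frequently)
    then show ?thesis
    proof (rule frequently_elim1, clarify)
      fix h x y
      assume A: "\<forall>a\<in>A. \<bar>h (a + k) - h a\<bar> \<le> k - 1"
        and r: "\<forall>p\<in>P. case p of (x, y) \<Rightarrow> \<bar>h (max x y) - h (min x y + int (q x y) * k)\<bar> \<le> k + C"
        and xy: "(x, y) \<in> P"
      have "\<bar>h (min x y + int (q x y) * k) - h (min x y)\<bar> \<le> int (q x y) * (k - 1)"
      proof (rule telescope_le)
        fix i assume "i < q x y"
        then have "min x y + int i * k \<in> A" unfolding A_def using xy by fast
        with A show "\<bar>h (min x y + int i * k + k) - h (min x y + int i * k)\<bar> \<le> k - 1" by blast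
      qed
      moreover have "\<bar>h (max x y) - h (min x y + int (q x y) * k)\<bar> \<le> k + C" using r xy by auto
      ultimately have "\<bar>h (max x y) - h (min x y)\<bar> \<le> int (q x y) * (k - 1) + (k + C)" by linarith
      moreover have "\<bar>h (max x y) - h (min x y)\<bar> = \<bar>h x - h y\<bar>" by (auto simp: max_def min_def)
      moreover have "int (q x y) = \<bar>x - y\<bar> div k" unfolding q_def using k
        by (simp add: pos_imp_zdiv_nonneg_iff)
      ultimately show "\<bar>h x - h y\<bar> \<le> (k - 1) * (\<bar>x - y\<bar> div k) + (k + C)"
        by (simp add: mult.commute)
    qed
  qed
  then show ?thesis using C(1) k by (intro exI[of _ "k + C"]) auto
qed

text \<open>Rounds of shrinking can be iterated, because images of bounded pairs are bounded pairs.
  The induction is on the excess over \<open>B\<close>.\<close>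

lemma shrink_bounded:
  assumes "tight k" "reach k d" "\<not> reach d k"
  shows "\<exists>B\<ge>0. \<forall>P. finite P \<longrightarrow> (\<forall>(x, y)\<in>P. bnd (x - y)) \<longrightarrow>
    (\<exists>\<^sub>F h in homs. \<forall>(x, y)\<in>P. \<bar>h x - h y\<bar> \<le> B)"
proof -
  have k: "1 \<le> k" using assms(1) tight_def by simp
  obtain C where C: "C \<ge> 0" "\<And>P. finite P \<Longrightarrow> (\<forall>(x, y)\<in>P. bnd (x - y)) \<Longrightarrow>
    (\<exists>\<^sub>F h in homs. \<forall>(x, y)\<in>P. \<bar>h x - h y\<bar> \<le> (k - 1) * (\<bar>x - y\<bar> div k) + C)"
    using shrink_pairs[OF assms] by blast
  \<comment> \<open>The balance point of one round: with \<open>q = z div k\<close>, the value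
    \<open>(k - 1) * q + C\<close> is at most \<open>k * C\<close> if \<open>q \<le> C\<close>, and
    less than \<open>z\<close> if \<open>q > C\<close>.\<close>
  define B where "B = k * C"
  have *: "\<exists>\<^sub>F h in homs. \<forall>(x, y)\<in>P. \<bar>h x - h y\<bar> \<le> B"
    if "finite P" "\<forall>(x, y)\<in>P. bnd (x - y) \<and> \<bar>x - y\<bar> \<le> B + int D" for P D
    using that
  proof (induction D arbitrary: P)
    case 0 then show ?case by (intro frequently_id) auto
  next
    case (Suc D)
    have red: "(k - 1) * (z div k) + C \<le> B + int D" if "0 \<le> z" "z \<le> B + int D + 1" for z
    proof (cases "z div k \<le> C")
      case True
      then have "(k - 1) * (z div k) \<le> (k - 1) * C" using k by (intro mult_left_mono) auto
      then show ?thesis unfolding B_def by (simp add: algebra_simps)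
    next
      case False
      have "k * (z div k) \<le> z" using k mult_div_mod_eq[of k z] pos_mod_sign[of k z] by linarith
      then show ?thesis using False that by (simp add: algebra_simps)
    qed
    have "\<exists>\<^sub>F h in homs. \<forall>(x, y)\<in>P. \<bar>h x - h y\<bar> \<le> (k - 1) * (\<bar>x - y\<bar> div k) + C"
      by (rule C(2)) (use Suc.prems in auto)
    moreover have "\<forall>\<^sub>F h in homs. \<forall>p\<in>P. case p of (x, y) \<Rightarrow> bnd \<bar>h x - h y\<bar>"
    proof (rule eventually_ball_finite[OF Suc.prems(1)], clarify)
      fix x y assume "(x, y) \<in> P"
      then have "bnd (x - y)" using Suc.prems by auto
      then have "\<forall>\<^sub>F h in homs. bnd \<bar>h (x - y) - h 0\<bar>"
        using bnd_trans by (intro eventually_reach) blast+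
      then show "\<forall>\<^sub>F h in homs. bnd \<bar>h x - h y\<bar>" by (rule eventually_pair) simp
    qed
    ultimately have "\<exists>\<^sub>F h in homs. (\<forall>p\<in>P. case p of (x, y) \<Rightarrow> bnd \<bar>h x - h y\<bar>) \<and>
       (\<forall>(x, y)\<in>P. \<bar>h x - h y\<bar> \<le> (k - 1) * (\<bar>x - y\<bar> div k) + C)"
      by (rule frequently_eventually_conj)
    then have "\<exists>\<^sub>F h in homs. \<exists>\<^sub>F g in homs. \<forall>(x, y)\<in>P. \<bar>g (h x) - g (h y)\<bar> \<le> B"
    proof (rule frequently_elim1, elim conjE)
      fix h assume 1: "\<forall>p\<in>P. case p of (x, y) \<Rightarrow> bnd \<bar>h x - h y\<bar>"
       and 2: "\<forall>(x, y)\<in>P. \<bar>h x - h y\<bar> \<le> (k - 1) * (\<bar>x - y\<bar> div k) + C"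
      have "\<exists>\<^sub>F g in homs. \<forall>(x, y)\<in>map_prod h h ` P. \<bar>g x - g y\<bar> \<le> B"
      proof (rule Suc.IH)
        show "finite (map_prod h h ` P)" using Suc.prems by simp
        have "bnd (h x - h y) \<and> \<bar>h x - h y\<bar> \<le> B + int D" if "(x, y) \<in> P" for x y
        proof -
          have "bnd (h x - h y)" using 1 that bnd_abs by fastforce
          moreover have "\<bar>h x - h y\<bar> \<le> (k - 1) * (\<bar>x - y\<bar> div k) + C" using 2 that by auto
          moreover have "\<bar>x - y\<bar> \<le> B + int D + 1" using Suc.prems that by force
          ultimately show ?thesis using red[of "\<bar>x - y\<bar>"] by linarith
        qed
        then show "\<forall>(x, y)\<in>map_prod h h ` P. bnd (x - y) \<and> \<bar>x - y\<bar> \<le> B + int D" by auto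
      qed
      then show "\<exists>\<^sub>F g in homs. \<forall>(x, y)\<in>P. \<bar>g (h x) - g (h y)\<bar> \<le> B"
        by (rule frequently_elim1) auto
    qed
    then show ?case by (rule frequently_comp)
  qed
  have "\<exists>\<^sub>F h in homs. \<forall>(x, y)\<in>P. \<bar>h x - h y\<bar> \<le> B"
    if P: "finite P" "\<forall>(x, y)\<in>P. bnd (x - y)" for P
  proof (rule *[OF P(1), of "nat (\<Sum>(x, y)\<in>P. \<bar>x - y\<bar>)"], clarify)
    fix x y assume xy: "(x, y) \<in> P"
    have "(case (x, y) of (x, y) \<Rightarrow> \<bar>x - y\<bar>) \<le> (\<Sum>(x, y)\<in>P. \<bar>x - y\<bar>)"
      by (rule member_le_sum[OF xy]) (use P(1) in auto)
    moreover have "0 \<le> B" unfolding B_def using k C(1) by simp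
    ultimately show "bnd (x - y) \<and> \<bar>x - y\<bar> \<le> B + int (nat (\<Sum>(x, y)\<in>P. \<bar>x - y\<bar>))"
      using P(2) xy by auto
  qed
  moreover have "0 \<le> B" unfolding B_def using k C(1) by simp
  ultimately show ?thesis by blast
qed

section \<open>Rigidity of tight distances when all shrinking is reversible\<close>

lemma tight_reach_le: "tight t \<Longrightarrow> reach t d \<Longrightarrow> d \<le> t"
proof (rule ccontr)
  assume t: "tight t" and "reach t d" and "\<not> d \<le> t"
  then have "\<exists>\<^sub>F h in homs. \<bar>h t - h 0\<bar> = d \<and> \<bar>h t - h 0\<bar> \<le> t"
    unfolding reach_def tight_def by (intro frequently_eventually_frequently) auto
  then show False using \<open>\<not> d \<le> t\<close> by (auto dest: frequently_ex)
qed

text \<open>Suppose some pair at a multiple of distance \<open>t\<close> shrinks, and let \<open>c\<close> be the largest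
  possible loss, attained by \<open>m * t \<mapsto> d = m * t - c\<close>. Since \<open>d\<close> can be expanded back by
  \<open>c\<close>, while no pair at distance \<open>d\<close> can shrink, the images of \<open>0, d, 2 * d, \<dots>, t * d\<close>
  either spread too far for the tight distance \<open>t * d\<close> or fold back and lose more than \<open>c\<close>.\<close>

lemma tight_frozen:
  assumes t: "tight t"
    and rev: "\<And>k d. tight k \<Longrightarrow> reach k d \<Longrightarrow> reach d k"
  shows "\<forall>\<^sub>F h in homs. \<bar>h t - h 0\<bar> = t"
proof (rule ccontr)
  assume neg: "\<not> ?thesis"
  have t1: "1 \<le> t" using t tight_def by simp
  obtain C where C: "C \<ge> 0" "\<And>d. d \<ge> 0 \<Longrightarrow> bnd d \<Longrightarrow> \<forall>\<^sub>F h in homs. \<bar>h d - h 0\<bar> \<le> d + C"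
    using tight_lipschitz[OF t] by blast
  \<comment> \<open>The losses that occur at multiples of \<open>t\<close>. They are at most
    \<open>C\<close>: by \<open>rev\<close> a shrunk distance can be stretched back, and stretching
    never gains more than the Lipschitz constant.\<close>
  define L where "L = {c. 0 \<le> c \<and> (\<exists>m\<ge>1. reach (m * t) (m * t - c) \<and> 0 \<le> m * t - c)}"
  have L_le: "c \<le> C" if "c \<in> L" for c
  proof -
    from that obtain m where m: "1 \<le> m" "reach (m * t) (m * t - c)" "0 \<le> m * t - c"
      unfolding L_def by blast
    have tm: "tight (m * t)" using t m by (intro tight_mult)
    have "reach (m * t - c) (m * t)" by (rule rev[OF tm m(2)])
    moreover have "bnd (m * t - c)" using bnd_trans[OF m(2) tight_bnd[OF tm]] .
    ultimately have "\<exists>\<^sub>F h in homs. \<bar>h (m * t - c) - h 0\<bar> = m * t \<and> \<bar>h (m * t - c) - h 0\<bar> \<le> m * t - c + C"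
      unfolding reach_def using C(2) m(3) by (intro frequently_eventually_frequently) auto
    then show "c \<le> C" by (auto dest: frequently_ex)
  qed
  have "0 \<le> c" if "c \<in> L" for c using that unfolding L_def by simp
  with L_le have "L \<subseteq> {0..C}" by auto
  then have "finite L" by (rule finite_subset) simp
  obtain d0 where d0: "reach t d0" "d0 \<noteq> t" "0 \<le> d0"
    using reach_of_frequently[of "\<lambda>z. z \<noteq> t" t] neg tight_bnd[OF t]
    by (auto simp: frequently_def)
  then have "d0 < t" using tight_reach_le[OF t d0(1)] by simp
  then have dL: "t - d0 \<in> L" unfolding L_def using d0 by (auto intro!: exI[of _ 1])
  define c where "c = Max L"
  have cL: "c \<in> L" and cmax: "\<And>x. x \<in> L \<Longrightarrow> x \<le> c"
    unfolding c_def using \<open>finite L\<close> dL by (auto intro: Max_in)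
  have c1: "1 \<le> c" using cmax[OF dL] \<open>d0 < t\<close> by simp
  obtain m0 where m0: "1 \<le> m0" "reach (m0 * t) (m0 * t - c)" using cL unfolding L_def by blast
  \<comment> \<open>At least \<open>m0\<close>, so that the loss \<open>c\<close> still occurs, and
    large enough for \<open>d = m * t - c\<close> to exceed \<open>t * c\<close>, which will exclude
    the folded outcome of \<open>zigzag\<close>.\<close>
  define m where "m = m0 + c + t * c + 1"
  have m: "m0 \<le> m" "1 \<le> m" "c + t * c + 1 \<le> m" unfolding m_def using m0 c1 t1 by auto
  have "m \<le> m * t" using t1 m by simp
  have mt: "tight (m * t)" using t m by (intro tight_mult)
  define d where "d = m * t - c"
  have tc: "0 \<le> t * c" using t1 c1 by simp
  then have d: "1 \<le> d" "t * c < d" unfolding d_def using \<open>m \<le> m * t\<close> m by linarith+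
  have loss: "d \<le> d'" if "reach (m * t) d'" "0 \<le> d'" for d'
  proof -
    have "d' \<le> m * t" using tight_reach_le[OF mt that(1)] .
    then have "m * t - d' \<in> L" unfolding L_def using that m(2) by auto
    from cmax[OF this] show "d \<le> d'" unfolding d_def by simp
  qed
  \<comment> \<open>The additional stretch \<open>(m - m0) * t\<close> cannot expand, so a loss of
    at least \<open>c\<close> carries over from \<open>m0 * t\<close> to \<open>m * t\<close>; by
    \<open>loss\<close> it is exactly \<open>c\<close>.\<close>
  have rd: "reach (m * t) d"
  proof -
    have "\<forall>\<^sub>F h in homs. \<bar>h ((m - m0) * t) - h 0\<bar> \<le> (m - m0) * t" using t m by (intro tight_mult_le) auto
    then have "\<forall>\<^sub>F h in homs. \<bar>h (m * t) - h (m0 * t)\<bar> \<le> (m - m0) * t"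
      by (rule eventually_pair) (simp add: algebra_simps)
    from frequently_eventually_frequently[OF m0(2)[unfolded reach_def] this]
    have "\<exists>\<^sub>F h in homs. \<bar>h (m * t) - h 0\<bar> \<le> d"
    proof (rule frequently_elim1)
      fix h assume "\<bar>h (m0 * t) - h 0\<bar> = m0 * t - c \<and> \<bar>h (m * t) - h (m0 * t)\<bar> \<le> (m - m0) * t"
      then show "\<bar>h (m * t) - h 0\<bar> \<le> d" unfolding d_def left_diff_distrib by linarith
    qed
    then obtain d' where "reach (m * t) d'" "d' \<le> d" "0 \<le> d'"
      using reach_of_frequently[of "\<lambda>z. z \<le> d" "m * t"] tight_bnd[OF mt] by blast
    with loss show ?thesis by force
  qed
  have bd: "bnd d" using bnd_trans[OF rd tight_bnd[OF mt]] .
  \<comment> \<open>Whatever \<open>d\<close> reaches is reached from \<open>m * t\<close> too: it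
    is at least \<open>d\<close> by maximality of \<open>c\<close>, and at most
    \<open>m * t = d + c\<close> by tightness.\<close>
  have "\<forall>\<^sub>F h in homs. d \<le> \<bar>h d - h 0\<bar> \<and> \<bar>h d - h 0\<bar> \<le> d + c"
  proof (rule eventually_reach[OF bd])
    fix d' assume "reach d d'" "0 \<le> d'"
    then have "reach (m * t) d'" using rd reach_trans by blast
    then show "d \<le> d' \<and> d' \<le> d + c" using loss \<open>0 \<le> d'\<close> tight_reach_le[OF mt] unfolding d_def by auto
  qed
  then have st: "\<forall>\<^sub>F h in homs. d \<le> \<bar>h (int (Suc j) * d) - h (int j * d)\<bar> \<and>
      \<bar>h (int (Suc j) * d) - h (int j * d)\<bar> \<le> d + c" for j
    by (rule eventually_pair) (simp add: algebra_simps)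
  have td: "tight (d * t)" using t d by (intro tight_mult)
  \<comment> \<open>The reason for taking \<open>t\<close> steps of length \<open>d\<close>: they
    end at a multiple of \<open>t\<close>, to which both tightness and the maximal loss
    \<open>c\<close> apply.\<close>
  have end_pos: "\<forall>\<^sub>F h in homs. \<bar>h (d * t) - h 0\<bar> \<le> d * t \<and> d * t - c \<le> \<bar>h (d * t) - h 0\<bar>"
  proof (rule eventually_reach[OF tight_bnd[OF td]])
    fix d' assume r: "reach (d * t) d'" "0 \<le> d'"
    then have "d' \<le> d * t" using tight_reach_le[OF td] by blast
    moreover have "d * t - d' \<in> L" unfolding L_def using r d \<open>d' \<le> d * t\<close> by auto
    ultimately show "d' \<le> d * t \<and> d * t - c \<le> d'" using cmax by force
  qed
  have "reach d (m * t)" by (rule rev[OF mt rd])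
  then have "\<exists>\<^sub>F h in homs. \<bar>h d - h 0\<bar> = d + c" unfolding reach_def d_def by simp
  moreover have "\<forall>\<^sub>F h in homs. (\<forall>j\<in>{..<nat t}. d \<le> \<bar>h (int (Suc j) * d) - h (int j * d)\<bar> \<and>
      \<bar>h (int (Suc j) * d) - h (int j * d)\<bar> \<le> d + c) \<and>
      \<bar>h (d * t) - h 0\<bar> \<le> d * t \<and> d * t - c \<le> \<bar>h (d * t) - h 0\<bar>"
    by (intro eventually_conj end_pos eventually_ball_finite ballI st) simp
  ultimately have "\<exists>\<^sub>F h in homs. \<bar>h d - h 0\<bar> = d + c \<and>
      (\<forall>j\<in>{..<nat t}. d \<le> \<bar>h (int (Suc j) * d) - h (int j * d)\<bar> \<and>
      \<bar>h (int (Suc j) * d) - h (int j * d)\<bar> \<le> d + c) \<and>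
      \<bar>h (d * t) - h 0\<bar> \<le> d * t \<and> d * t - c \<le> \<bar>h (d * t) - h 0\<bar>"
    by (rule frequently_eventually_frequently)
  then obtain h where h: "\<bar>h d - h 0\<bar> = d + c"
      "\<And>j. j < nat t \<Longrightarrow> d \<le> \<bar>h (int (Suc j) * d) - h (int j * d)\<bar> \<and>
      \<bar>h (int (Suc j) * d) - h (int j * d)\<bar> \<le> d + c"
      "\<bar>h (d * t) - h 0\<bar> \<le> d * t" "d * t - c \<le> \<bar>h (d * t) - h 0\<bar>"
    by (auto dest!: frequently_ex)
  have "int (nat t) * d + c \<le> \<bar>h (int (nat t) * d) - h (int 0 * d)\<bar> \<or>
      \<bar>h (int (nat t) * d) - h (int 0 * d)\<bar> \<le> (int (nat t) - 2) * d + (int (nat t) - 1) * c"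
    by (rule zigzag[of c d "\<lambda>j. h (int j * d)"]) (use c1 d h t1 in auto)
  then show False
  proof
    assume "int (nat t) * d + c \<le> \<bar>h (int (nat t) * d) - h (int 0 * d)\<bar>"
    then show False using h(3) t1 c1 by (simp add: mult.commute)
  next
    assume "\<bar>h (int (nat t) * d) - h (int 0 * d)\<bar> \<le> (int (nat t) - 2) * d + (int (nat t) - 1) * c"
    then have "\<bar>h (d * t) - h 0\<bar> \<le> d * t - 2 * d + t * c - c" using t1 by (simp add: algebra_simps)
    then show False using h(4) d tc by linarith
  qed
qed

subsection \<open>Separating and merging points\<close>

lemma hom_translate: "hom S h \<Longrightarrow> (\<And>x. x \<in> T \<Longrightarrow> x + a \<in> S) \<Longrightarrow> hom T (\<lambda>x. h (x + a) - b)"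
proof -
  assume h: "hom S h" and T: "\<And>x. x \<in> T \<Longrightarrow> x + a \<in> S"
  have "hom T (\<lambda>x. x + a)" by (rule hom_capeq[OF hom_id]) (auto simp: capeq_def)
  moreover have "hom ((\<lambda>x. x + a) ` T) h" by (rule hom_mono[OF h]) (use T in auto)
  ultimately have "hom T (\<lambda>x. h (x + a))" by (rule hom_comp)
  then show ?thesis by (rule hom_capeq) (auto simp: capeq_def)
qed

text \<open>Only the number of image points matters, since \<open>compress\<close> closes the gaps
  between them.\<close>

lemma bounded_of_card:
  assumes "\<And>S. finite S \<Longrightarrow> \<exists>h. hom S h \<and> card (h ` S) \<le> c" "finite S"
  shows "\<exists>h. hom S h \<and> h ` S \<subseteq> {0..int c * (N + 1)}"
proof -
  obtain h where h: "hom S h" "card (h ` S) \<le> c" using assms by blast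
  obtain g where g: "\<forall>x\<in>h ` S. \<forall>y\<in>h ` S. capeq N (x - y) (g x - g y)"
     "g ` h ` S \<subseteq> {0..int (card (h ` S)) * (N + 1)}"
    using compress[of "h ` S" N] assms(2) N_nonneg by auto
  have "hom S (\<lambda>x. g (h x))" by (rule hom_capeq[OF h(1)]) (use g in auto)
  moreover have "int (card (h ` S)) * (N + 1) \<le> int c * (N + 1)"
    using h(2) N_nonneg by (intro mult_right_mono) auto
  ultimately show ?thesis using g(2) by (intro exI[of _ "\<lambda>x. g (h x)"]) force
qed

text \<open>Images at or below \<open>z\<close> differ from those above \<open>z\<close> by more
  than \<open>N\<close>, before and after the shift, so truncated differences do not change.\<close>

lemma hom_split:
  assumes "hom S h" "\<And>p. p \<in> S \<Longrightarrow> h p \<le> z \<Longrightarrow> h p + N < z" "0 \<le> s"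
  shows "hom S (\<lambda>x. if h x \<le> z then h x else h x + s)"
proof (rule hom_capeq[OF assms(1)])
  fix x y assume "x \<in> S" "y \<in> S"
  with assms(2)[of x] assms(2)[of y]
  show "capeq N (h x - h y) ((if h x \<le> z then h x else h x + s) - (if h y \<le> z then h y else h y + s))"
    using assms(3) unfolding capeq_def by auto
qed

text \<open>An unbounded pair can be stretched beyond the total length of all windows at image
  points of \<open>S\<close>; counting then leaves a place to cut between its two images.\<close>

lemma not_bnd_gap:
  assumes "\<not> bnd (x - y)" "finite S"
  obtains h z where "hom S h" "\<And>p. p \<in> S \<Longrightarrow> h p \<le> z \<Longrightarrow> h p + N < z"
    "(h x \<le> z \<and> z < h y) \<or> (h y \<le> z \<and> z < h x)"
proof -
  define L where "L = int (card S) * (N + 1)"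
  have "\<exists>\<^sub>F h in homs. \<not> \<bar>h (x - y) - h 0\<bar> \<le> L" using assms(1) unfolding bnd_def frequently_def by simp
  then have "\<exists>\<^sub>F h in homs. \<not> \<bar>h x - h y\<bar> \<le> L" by (rule frequently_pair) simp
  from frequently_homsE[OF this assms(2)] obtain h where h: "hom S h" "\<not> \<bar>h x - h y\<bar> \<le> L" .
  have "int (card (h ` S)) * (N + 1) \<le> L" unfolding L_def
    using card_image_le[OF assms(2), of h] N_nonneg by (intro mult_right_mono) auto
  then have "max (h x) (h y) - min (h x) (h y) > int (card (h ` S)) * (N + 1)" using h(2) by linarith
  from exists_gap[OF _ N_nonneg this] obtain z where
    z: "min (h x) (h y) \<le> z" "z < max (h x) (h y)" "\<forall>p\<in>h ` S. p \<le> z \<longrightarrow> p + N < z"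
    using assms(2) by auto
  show thesis
  proof (rule that[OF h(1)])
    show "(h x \<le> z \<and> z < h y) \<or> (h y \<le> z \<and> z < h x)" using z(1,2) by linarith
  qed (use z in auto)
qed

text \<open>Stretch \<open>x\<close> and \<open>y\<close> apart, cut the image between them and
  shift the upper part until the two are exactly \<open>D\<close> apart. After translation
  everything lies in \<open>{- W..D + W}\<close>, where a map identifying \<open>0\<close> and
  \<open>D\<close> is available.\<close>

lemma merge_pair:
  assumes "\<And>W. \<exists>D\<ge>W. \<exists>h. hom {- W..D + W} h \<and> h 0 = h D" "\<not> bnd (x - y)"
  shows "\<exists>\<^sub>F h in homs. h x = h y"
  unfolding frequently_homs
proof (intro allI impI)
  fix S :: "int set" assume "finite S"
  define T where "T = insert x (insert y S)"
  have T: "finite T" "x \<in> T" "y \<in> T" "S \<subseteq> T" unfolding T_def using \<open>finite S\<close> by auto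
  obtain h z where h: "hom T h" "\<And>p. p \<in> T \<Longrightarrow> h p \<le> z \<Longrightarrow> h p + N < z"
    "(h x \<le> z \<and> z < h y) \<or> (h y \<le> z \<and> z < h x)" using not_bnd_gap[OF assms(2) T(1)] by blast
  define u v where "u = min (h x) (h y)" and "v = max (h x) (h y)"
  have uv: "u \<le> z" "z < v" using h(3) unfolding u_def v_def by auto
  \<comment> \<open>Bounds the distance of every image point from \<open>u\<close>. In particular
    \<open>v - u \<le> W \<le> D\<close>, so the shift by \<open>D - (v - u)\<close> goes
    upwards.\<close>
  define W where "W = (\<Sum>p\<in>T. \<bar>h p - u\<bar>)"
  have W: "\<bar>h p - u\<bar> \<le> W" if "p \<in> T" for p unfolding W_def
    by (rule member_le_sum[OF that]) (use T in auto)
  obtain D e where D: "D \<ge> W" "hom {- W..D + W} e" "e 0 = e D" using assms(1)[of W] by blast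
  have vu: "v - u \<le> W" using W[OF T(2)] W[OF T(3)] unfolding u_def v_def by (auto simp: max_def min_def)
  define f where "f p = (if h p \<le> z then h p else h p + (D - (v - u)))" for p
  have "hom T f" unfolding f_def by (rule hom_split[OF h(1,2)]) (use vu D in auto)
  then have "hom T (\<lambda>p. f p - u)" by (rule hom_capeq) (auto simp: capeq_def)
  moreover have "hom ((\<lambda>p. f p - u) ` T) e"
  proof (rule hom_mono[OF D(2)], clarify)
    fix p assume "p \<in> T"
    with W[OF this] show "f p - u \<in> {- W..D + W}" unfolding f_def using uv vu D(1) by auto
  qed
  ultimately have "hom T (\<lambda>p. e (f p - u))" by (rule hom_comp)
  then have "hom S (\<lambda>p. e (f p - u))" using T hom_mono by blast
  moreover have "e (f x - u) = e (f y - u)"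
    using h(3) D(3) unfolding f_def u_def v_def by auto
  ultimately show "\<exists>h. hom S h \<and> h x = h y" by (intro exI[of _ "\<lambda>p. e (f p - u)"]) simp
qed

text \<open>Each new pair is brought into \<open>P\<close> by a map chosen after the earlier ones,
  and \<open>pers\<close> keeps the earlier pairs there. The instances are equality of the images
  and divisibility of their difference by \<open>g\<close>.\<close>

lemma frequently_merge:
  assumes "\<And>x y :: int. x \<noteq> y \<Longrightarrow> \<exists>\<^sub>F h in homs. P (h x - h y)" "P 0"
    and pers: "\<And>x y. P (x - y) \<Longrightarrow> \<forall>\<^sub>F h in homs. P (h x - h y)"
    and "finite R"
  shows "\<exists>\<^sub>F h in homs. \<forall>(x, y)\<in>R. P (h x - h y)"
  using \<open>finite R\<close>
proof (induction R)
  case empty then show ?case by (simp add: frequently_id)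
next
  case (insert r R)
  obtain a b where r: "r = (a, b)" by (cases r)
  have step: "\<exists>\<^sub>F g in homs. \<forall>(x, y)\<in>insert r R. P (g (h x) - g (h y))" if "\<forall>(x, y)\<in>R. P (h x - h y)" for h
  proof -
    have ev: "\<forall>\<^sub>F g in homs. \<forall>p\<in>R. case p of (x, y) \<Rightarrow> P (g (h x) - g (h y))"
      using that by (intro eventually_ball_finite[OF insert.hyps(1)]) (auto simp: pers)
    have fr: "\<exists>\<^sub>F g in homs. P (g (h a) - g (h b))"
      using assms(1)[of "h a" "h b"] assms(2) by (cases "h a = h b") (simp_all add: frequently_id)
    show ?thesis using frequently_eventually_frequently[OF fr ev] r by (auto elim: frequently_elim1)
  qed
  show ?case
  proof (rule frequently_comp)
    from insert.IH show "\<exists>\<^sub>F h in homs. \<exists>\<^sub>F g in homs. \<forall>(x, y)\<in>insert r R. P (g (h x) - g (h y))"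
    proof (rule frequently_elim1)
      fix h assume "\<forall>(x, y)\<in>R. P (h x - h y)"
      then show "\<exists>\<^sub>F g in homs. \<forall>(x, y)\<in>insert r R. P (g (h x) - g (h y))" by (rule step)
    qed
  qed
qed

lemma merge_all:
  assumes "\<And>W. \<exists>D\<ge>W. \<exists>h. hom {- W..D + W} h \<and> h 0 = h D" "\<And>d. d \<noteq> 0 \<Longrightarrow> \<not> bnd d" "finite S"
  shows "\<exists>h. hom S h \<and> card (h ` S) \<le> 1"
proof -
  have "\<exists>\<^sub>F h in homs. \<forall>(x, y)\<in>S \<times> S. h x - h y = 0"
  proof (rule frequently_merge)
    fix x y :: int assume "x \<noteq> y"
    then show "\<exists>\<^sub>F h in homs. h x - h y = 0" using merge_pair[OF assms(1), of x y] assms(2) by simp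
  next
    fix x y :: int assume "x - y = 0"
    then show "\<forall>\<^sub>F h in homs. h x - h y = 0" by simp
  qed (use assms(3) in auto)
  from frequently_homsE[OF this assms(3)] obtain h
    where h: "hom S h" "\<forall>(x, y)\<in>S \<times> S. h x - h y = 0" by blast
  have "card (h ` S) \<le> 1"
  proof (cases "S = {}")
    case False
    then obtain a where "a \<in> S" by blast
    have "h x = h a" if "x \<in> S" for x
      using bspec[OF h(2), of "(x, a)"] that \<open>a \<in> S\<close> by simp
    then have "h ` S = {h a}" using \<open>a \<in> S\<close> by blast
    then show ?thesis by simp
  qed simp
  then show ?thesis using h(1) by blast
qed

text \<open>Take a maximal set \<open>P\<close> of pairs that can be separated simultaneously beyond
  every bound. By maximality every other pair is bounded once \<open>P\<close> is separated far
  enough, and \<open>L\<close> dominates these finitely many bounds. The function \<Lambda> is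
  arbitrary because the separation needed later depends on \<open>L\<close>.\<close>

lemma exists_dichotomy:
  fixes \<Lambda> :: "int \<Rightarrow> int"
  assumes S: "finite S"
  shows "\<exists>L\<ge>N. \<exists>f. hom S f \<and> (\<forall>x\<in>S. \<forall>y\<in>S. \<bar>f x - f y\<bar> \<le> L \<or> \<Lambda> L < \<bar>f x - f y\<bar>) \<and>
    (\<forall>f'. hom S f' \<longrightarrow> (\<forall>x\<in>S. \<forall>y\<in>S. L < \<bar>f x - f y\<bar> \<longrightarrow> L < \<bar>f' x - f' y\<bar>) \<longrightarrow>
      (\<forall>x\<in>S. \<forall>y\<in>S. \<bar>f x - f y\<bar> \<le> L \<longrightarrow> \<bar>f' x - f' y\<bar> \<le> L))"
proof -
  define Sep where "Sep P \<longleftrightarrow> (\<forall>L. \<exists>f. hom S f \<and> (\<forall>(x, y)\<in>P. L < \<bar>f x - f y\<bar>))" for P :: "(int \<times> int) set"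
  let ?Q = "{P. P \<subseteq> S \<times> S \<and> Sep P}"
  have "Sep {}" unfolding Sep_def using hom_id by blast
  moreover have "finite ?Q" by (rule finite_subset[of _ "Pow (S \<times> S)"]) (use S in auto)
  ultimately obtain P where P: "P \<in> ?Q" "\<And>P'. P' \<in> ?Q \<Longrightarrow> P \<subseteq> P' \<Longrightarrow> P = P'"
    using finite_has_maximal[of ?Q] by (metis (no_types, lifting) empty_subsetI equals0D mem_Collect_eq)
  have "\<exists>L. p \<in> S \<times> S - P \<longrightarrow> (\<forall>f. hom S f \<longrightarrow> (\<forall>(x, y)\<in>P. L < \<bar>f x - f y\<bar>) \<longrightarrow> \<bar>f (fst p) - f (snd p)\<bar> \<le> L)" for p
  proof (cases "p \<in> S \<times> S - P")
    case True
    then have "\<not> Sep (insert p P)" using P(2)[of "insert p P"] P(1) by auto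
    then obtain L where "\<And>f. hom S f \<Longrightarrow> \<not> (\<forall>(x, y)\<in>insert p P. L < \<bar>f x - f y\<bar>)" unfolding Sep_def by blast
    then have "\<bar>f (fst p) - f (snd p)\<bar> \<le> L" if "hom S f" "\<forall>(x, y)\<in>P. L < \<bar>f x - f y\<bar>" for f
      using that by (force simp: case_prod_beta)
    then show ?thesis by blast
  qed auto
  then obtain Lf where Lf: "\<And>p f. p \<in> S \<times> S - P \<Longrightarrow> hom S f \<Longrightarrow> (\<forall>(x, y)\<in>P. Lf p < \<bar>f x - f y\<bar>) \<Longrightarrow> \<bar>f (fst p) - f (snd p)\<bar> \<le> Lf p"
    using choice[of "\<lambda>p L. p \<in> S \<times> S - P \<longrightarrow> (\<forall>f. hom S f \<longrightarrow> (\<forall>(x, y)\<in>P. L < \<bar>f x - f y\<bar>) \<longrightarrow> \<bar>f (fst p) - f (snd p)\<bar> \<le> L)"] by blast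
  define L where "L = N + (\<Sum>p\<in>S \<times> S. \<bar>Lf p\<bar>)"
  have "N \<le> L" unfolding L_def by (simp add: sum_nonneg)
  have L: "Lf p \<le> L" if "p \<in> S \<times> S" for p
  proof -
    have "\<bar>Lf p\<bar> \<le> (\<Sum>p\<in>S \<times> S. \<bar>Lf p\<bar>)" by (rule member_le_sum[OF that]) (use S in auto)
    then show ?thesis unfolding L_def using N_nonneg by linarith
  qed
  have key: "\<bar>f x - f y\<bar> \<le> L" if "hom S f" "\<forall>(x, y)\<in>P. L < \<bar>f x - f y\<bar>" "x \<in> S" "y \<in> S" "(x, y) \<notin> P" for f x y
  proof -
    have "\<forall>(x', y')\<in>P. Lf (x, y) < \<bar>f x' - f y'\<bar>" using that L[of "(x, y)"] by fastforce
    then show ?thesis using Lf[of "(x, y)" f] L[of "(x, y)"] that by simp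
  qed
  obtain f where f: "hom S f" "\<forall>(x, y)\<in>P. max L (\<Lambda> L) < \<bar>f x - f y\<bar>" using P(1) unfolding Sep_def by blast
  have fP: "\<forall>(x, y)\<in>P. L < \<bar>f x - f y\<bar>" using f(2) by auto
  show ?thesis
  proof (intro exI[of _ L] exI[of _ f] conjI ballI allI impI)
    fix x y assume "x \<in> S" "y \<in> S"
    then show "\<bar>f x - f y\<bar> \<le> L \<or> \<Lambda> L < \<bar>f x - f y\<bar>"
      using key[OF f(1) fP] f(2) by (cases "(x, y) \<in> P") auto
  next
    fix f' x y assume f': "hom S f'" "\<forall>x\<in>S. \<forall>y\<in>S. L < \<bar>f x - f y\<bar> \<longrightarrow> L < \<bar>f' x - f' y\<bar>"
      and xy: "x \<in> S" "y \<in> S" "\<bar>f x - f y\<bar> \<le> L"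
    have "\<forall>(x, y)\<in>P. L < \<bar>f' x - f' y\<bar>" using f'(2) fP P(1) by blast
    moreover have "(x, y) \<notin> P" using fP xy by force
    ultimately show "\<bar>f' x - f' y\<bar> \<le> L" using key[OF f'(1)] xy by blast
  qed (use \<open>N \<le> L\<close> f in auto)
qed

text \<open>Take \<open>f\<close> whose image splits into clusters of diameter at most \<open>L\<close> that are much further
  apart, with a maximal set of separated pairs, and let \<open>g\<close> separate two points of one cluster.
  To keep the other pairs separated, offer \<open>q + 1\<close> shifted copies of every other cluster: as \<open>g\<close>
  does not identify distant points, few of the copies end up near a given point.\<close>

lemma spread_all:
  assumes unb: "\<And>d. d \<noteq> 0 \<Longrightarrow> \<not> bnd d"
    and W: "0 \<le> W" "\<And>D h. W \<le> D \<Longrightarrow> hom {- W..D + W} h \<Longrightarrow> h 0 \<noteq> h D"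
    and S: "finite S"
  shows "\<exists>h. hom S h \<and> (\<forall>x\<in>S. \<forall>y\<in>S. h x = h y \<or> N < \<bar>h x - h y\<bar>)"
proof -
  \<comment> \<open>Copies are shifted by multiples of \<open>w > W\<close>, so \<open>g\<close>
    cannot identify two copies of a point. Each pair of points excludes at most
    \<open>2 * L + 1\<close> copies, hence at most \<open>q L\<close> are excluded in total out of
    \<open>q L + 1\<close>. The bound \<open>\<Lambda> L\<close> leaves gaps above \<open>N\<close>
    after shifts of up to \<open>w * q L\<close>, and being at least \<open>2 * L\<close> it makes
    nearness transitive.\<close>
  define w where "w = W + 1"
  define q where "q L = int (card S * card S) * (2 * L + 1)" for L :: int
  define \<Lambda> where "\<Lambda> L = 2 * L + N + w * q L" for L
  obtain L f where L: "N \<le> L" and f: "hom S f"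
    and dich: "\<And>x y. x \<in> S \<Longrightarrow> y \<in> S \<Longrightarrow> \<bar>f x - f y\<bar> \<le> L \<or> \<Lambda> L < \<bar>f x - f y\<bar>"
    and maxi: "\<And>f' x y. hom S f' \<Longrightarrow> (\<forall>x\<in>S. \<forall>y\<in>S. L < \<bar>f x - f y\<bar> \<longrightarrow> L < \<bar>f' x - f' y\<bar>)
      \<Longrightarrow> x \<in> S \<Longrightarrow> y \<in> S \<Longrightarrow> \<bar>f x - f y\<bar> \<le> L \<Longrightarrow> \<bar>f' x - f' y\<bar> \<le> L"
    using exists_dichotomy[OF S, of \<Lambda>] by blast
  have q0: "0 \<le> q L" unfolding q_def using L N_nonneg by simp
  have w1: "1 \<le> w" "W \<le> w" unfolding w_def using W by auto
  have "f a = f b \<or> N < \<bar>f a - f b\<bar>" if ab: "a \<in> S" "b \<in> S" for a b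
  proof (rule ccontr)
    assume "\<not> ?thesis"
    then have fab: "f a \<noteq> f b" "\<bar>f a - f b\<bar> \<le> L" using L by auto
    define cl where "cl x = {y \<in> S. \<bar>f x - f y\<bar> \<le> L}" for x
    have big: "2 * L \<le> \<Lambda> L" unfolding \<Lambda>_def using N_nonneg q0 w1 by simp
    have near_trans: "\<bar>f x - f z\<bar> \<le> L" if "x \<in> S" "z \<in> S" "\<bar>f x - f y\<bar> \<le> L" "\<bar>f y - f z\<bar> \<le> L" for x y z
      using dich[OF that(1,2)] that(3,4) big by linarith
    have cl_iff: "cl x = cl y \<longleftrightarrow> \<bar>f x - f y\<bar> \<le> L" if "x \<in> S" "y \<in> S" for x y
    proof
      assume eq: "cl x = cl y"
      have "0 \<le> L" using L N_nonneg by simp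
      then have "y \<in> cl y" unfolding cl_def using that by simp
      then show "\<bar>f x - f y\<bar> \<le> L" using eq unfolding cl_def by blast
    next
      assume n: "\<bar>f x - f y\<bar> \<le> L"
      then have "\<bar>f y - f x\<bar> \<le> L" by linarith
      with n show "cl x = cl y" unfolding cl_def using near_trans that by blast
    qed
    define m M where "m = - (\<Sum>x\<in>S. \<bar>f x\<bar>)" and "M = (\<Sum>x\<in>S. \<bar>f x\<bar>) + w * q L"
    have range: "m \<le> f x + w * j" "f x + w * j \<le> M" if "x \<in> S" "0 \<le> j" "j \<le> q L" for x j
    proof -
      have "\<bar>f x\<bar> \<le> (\<Sum>x\<in>S. \<bar>f x\<bar>)" by (rule member_le_sum[OF that(1)]) (use S in auto)
      moreover have "0 \<le> w * j" "w * j \<le> w * q L" using w1 that by (auto intro: mult_left_mono)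
      ultimately show "m \<le> f x + w * j" "f x + w * j \<le> M" unfolding m_def M_def by linarith+
    qed
    have "\<exists>\<^sub>F h in homs. \<not> \<bar>h (f a - f b) - h 0\<bar> \<le> L"
      using unb[of "f a - f b"] fab(1) unfolding bnd_def frequently_def by simp
    then have "\<exists>\<^sub>F h in homs. \<not> \<bar>h (f a) - h (f b)\<bar> \<le> L" by (rule frequently_pair) simp
    \<comment> \<open>\<open>g\<close> has to preserve the whole interval that contains all copies,
      with a margin \<open>W\<close> on both sides for the windows in \<open>W(2)\<close>.\<close>
    then obtain g where g: "hom {m - W..M + W} g" "\<not> \<bar>g (f a) - g (f b)\<bar> \<le> L"
      by (rule frequently_homsE[where S="{m - W..M + W}"]) auto
    have apart: "g u \<noteq> g v" if "m \<le> u" "u + W \<le> v" "v \<le> M" for u v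
    proof -
      have "hom {- W..(v - u) + W} (\<lambda>x. g (x + u) - 0)"
        by (rule hom_translate[OF g(1)]) (use that in auto)
      from W(2)[OF _ this] that show ?thesis by simp
    qed
    have inj: "inj_on (\<lambda>j. g (f x + w * j)) {0..q L}" if "x \<in> S" for x
    proof (rule inj_onI, rule ccontr)
      have *: False if "i < j" "0 \<le> i" "j \<le> q L" "g (f x + w * i) = g (f x + w * j)" for i j
      proof -
        have "w * (i + 1) \<le> w * j" using that w1 by (intro mult_left_mono) auto
        then have "f x + w * i + W \<le> f x + w * j" using w1 by (simp add: algebra_simps)
        then show False using apart[of "f x + w * i" "f x + w * j"] range[OF \<open>x \<in> S\<close>] that by simp
      qed
      fix i j assume "i \<in> {0..q L}" "j \<in> {0..q L}" "g (f x + w * i) = g (f x + w * j)" "i \<noteq> j"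
      then show False using *[of i j] *[of j i] by (cases "i < j") auto
    qed
    \<comment> \<open>Clusters are added one by one; \<open>i c\<close> is the copy chosen for
      cluster \<open>c\<close>. The cluster of \<open>a\<close>, which contains \<open>b\<close>,
      keeps copy 0, so that \<open>g\<close> still sees \<open>f a\<close> and
      \<open>f b\<close>.\<close>
    have "\<exists>i. (\<forall>c. 0 \<le> i c \<and> i c \<le> q L) \<and> i (cl a) = 0 \<and> (\<forall>x\<in>S. \<forall>y\<in>S.
        cl x \<in> insert (cl a) A \<longrightarrow> cl y \<in> insert (cl a) A \<longrightarrow> cl x \<noteq> cl y \<longrightarrow>
        L < \<bar>g (f x + w * i (cl x)) - g (f y + w * i (cl y))\<bar>)" if "finite A" for A :: "int set set"
      using that
    proof (induction A)
      case empty
      show ?case using q0 by (intro exI[of _ "\<lambda>_. 0"]) auto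
    next
      case (insert \<kappa> A)
      from insert.IH obtain i where i: "\<forall>c. 0 \<le> i c \<and> i c \<le> q L" "i (cl a) = 0" and
        i3: "\<forall>x\<in>S. \<forall>y\<in>S. cl x \<in> insert (cl a) A \<longrightarrow> cl y \<in> insert (cl a) A \<longrightarrow> cl x \<noteq> cl y \<longrightarrow>
          L < \<bar>g (f x + w * i (cl x)) - g (f y + w * i (cl y))\<bar>" by (elim exE conjE)
      show ?case
      proof (cases "\<kappa> = cl a")
        case True
        then show ?thesis using i i3 by (intro exI[of _ i]) simp
      next
        case False
        define bad where "bad x y = {j \<in> {0..q L}. \<bar>g (f x + w * j) - g (f y + w * i (cl y))\<bar> \<le> L}" for x y
        have card_bad: "card (bad x y) \<le> nat (2 * L + 1)" if "x \<in> S" for x y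
        proof -
          let ?c = "g (f y + w * i (cl y))"
          have "card (bad x y) = card ((\<lambda>j. g (f x + w * j)) ` bad x y)"
            by (rule card_image[symmetric], rule inj_on_subset[OF inj[OF that]]) (auto simp: bad_def)
          also have "\<dots> \<le> card {?c - L..?c + L}" by (rule card_mono) (auto simp: bad_def)
          finally show ?thesis by simp
        qed
        have "card (\<Union>p\<in>S \<times> S. bad (fst p) (snd p)) \<le> (\<Sum>p\<in>S \<times> S. card (bad (fst p) (snd p)))"
          by (rule card_UN_le) (use S in auto)
        also have "\<dots> \<le> (\<Sum>p\<in>S \<times> S. nat (2 * L + 1))" by (rule sum_mono) (auto intro: card_bad)
        also have "\<dots> = card S * card S * nat (2 * L + 1)" by (simp add: card_cartesian_product)
        finally have "int (card (\<Union>p\<in>S \<times> S. bad (fst p) (snd p))) \<le> int (card S * card S * nat (2 * L + 1))"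
          by (simp only: of_nat_le_iff)
        also have "\<dots> = q L" unfolding q_def using L N_nonneg by simp
        finally have "int (card (\<Union>p\<in>S \<times> S. bad (fst p) (snd p))) \<le> q L" .
        then have "card (\<Union>p\<in>S \<times> S. bad (fst p) (snd p)) < card {0..q L}" using q0 by simp
        moreover have "finite (\<Union>p\<in>S \<times> S. bad (fst p) (snd p))" 
          by (rule finite_subset[of _ "{0..q L}"]) (auto simp: bad_def)
        ultimately have "\<not> {0..q L} \<subseteq> (\<Union>p\<in>S \<times> S. bad (fst p) (snd p))"
          using card_mono linorder_not_le by blast
        then obtain j where j: "0 \<le> j" "j \<le> q L" and j': "j \<notin> (\<Union>p\<in>S \<times> S. bad (fst p) (snd p))"
          unfolding subset_iff atLeastAtMost_iff by blast
        have jbad: "j \<notin> bad x y" if "x \<in> S" "y \<in> S" for x y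
          using j' that by (metis SigmaI UN_I fst_conv snd_conv)
        have good: "L < \<bar>g (f x + w * j) - g (f y + w * i (cl y))\<bar>" if "x \<in> S" "y \<in> S" for x y
          using jbad[OF that] j unfolding bad_def by auto
        then have good': "L < \<bar>g (f y + w * i (cl y)) - g (f x + w * j)\<bar>" if "x \<in> S" "y \<in> S" for x y
          using that by (subst abs_minus_commute)
        show ?thesis
        proof (intro exI[of _ "i(\<kappa> := j)"] conjI ballI impI allI)
          fix x y assume xy: "x \<in> S" "y \<in> S" "cl x \<in> insert (cl a) (insert \<kappa> A)"
            "cl y \<in> insert (cl a) (insert \<kappa> A)" "cl x \<noteq> cl y"
          consider "cl x = \<kappa>" | "cl y = \<kappa>" | "cl x \<noteq> \<kappa>" "cl y \<noteq> \<kappa>" by blast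
          then show "L < \<bar>g (f x + w * (i(\<kappa> := j)) (cl x)) - g (f y + w * (i(\<kappa> := j)) (cl y))\<bar>"
          proof cases
            case 1
            moreover have "cl y \<noteq> \<kappa>" using 1 xy(5) by blast
            ultimately show ?thesis using good[OF xy(1,2)] by (simp only: fun_upd_apply if_False if_True simp_thms)
          next
            case 2
            moreover have "cl x \<noteq> \<kappa>" using 2 xy(5) by blast
            ultimately show ?thesis using good'[OF xy(2,1)] by (simp only: fun_upd_apply if_False if_True simp_thms)
          next
            case 3
            have "cl x \<in> insert (cl a) A" "cl y \<in> insert (cl a) A" using 3 xy(3,4) by blast+
            then have "L < \<bar>g (f x + w * i (cl x)) - g (f y + w * i (cl y))\<bar>" using i3 xy(1,2,5) by blast
            then show ?thesis using 3 by (simp only: fun_upd_apply if_False simp_thms)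
          qed
        qed (use i j False in auto)
      qed
    qed
    from this[OF finite_imageI[OF S], of cl] obtain i where
      i: "\<forall>c. 0 \<le> i c \<and> i c \<le> q L" "i (cl a) = 0" and
      i3: "\<forall>x\<in>S. \<forall>y\<in>S. cl x \<in> insert (cl a) (cl ` S) \<longrightarrow> cl y \<in> insert (cl a) (cl ` S) \<longrightarrow>
        cl x \<noteq> cl y \<longrightarrow> L < \<bar>g (f x + w * i (cl x)) - g (f y + w * i (cl y))\<bar>"
      by (elim exE conjE)
    define e where "e x = f x + w * i (cl x)" for x
    have "hom S e"
    proof (rule hom_capeq[OF f])
      fix x y assume xy: "x \<in> S" "y \<in> S"
      show "capeq N (f x - f y) (e x - e y)"
      proof (cases "cl x = cl y")
        case True then show ?thesis unfolding e_def capeq_def by simp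
      next
        case False
        then have "\<Lambda> L < \<bar>f x - f y\<bar>" using cl_iff[OF xy] dich[OF xy] by blast
        moreover have "0 \<le> w * i c" "w * i c \<le> w * q L" for c using i(1) w1 by (auto intro: mult_left_mono)
        moreover have "0 \<le> L" using L N_nonneg by simp
        ultimately show ?thesis unfolding e_def capeq_def \<Lambda>_def by (smt (verit))
      qed
    qed
    moreover have "hom (e ` S) g"
    proof (rule hom_mono[OF g(1)], clarify)
      fix x assume "x \<in> S"
      then show "e x \<in> {m - W..M + W}" using range[of x "i (cl x)"] i(1) W(1) unfolding e_def by simp
    qed
    ultimately have "hom S (\<lambda>x. g (e x))" by (rule hom_comp)
    moreover have "\<forall>x\<in>S. \<forall>y\<in>S. L < \<bar>f x - f y\<bar> \<longrightarrow> L < \<bar>g (e x) - g (e y)\<bar>"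
    proof (intro ballI impI)
      fix x y assume xy: "x \<in> S" "y \<in> S" "L < \<bar>f x - f y\<bar>"
      then have "cl x \<noteq> cl y" using cl_iff[OF xy(1,2)] by linarith
      then show "L < \<bar>g (e x) - g (e y)\<bar>" using i3 xy(1,2) unfolding e_def by blast
    qed
    \<comment> \<open>The composite separates every pair that \<open>f\<close> separates, so by
      maximality it cannot separate \<open>a\<close> and \<open>b\<close> as well, although
      \<open>g\<close> was chosen to do so.\<close>
    ultimately have "\<bar>g (e a) - g (e b)\<bar> \<le> L" using maxi ab fab(2) by blast
    moreover have "e a = f a" "e b = f b" using i(2) cl_iff[OF ab] fab(2) unfolding e_def by simp_all
    ultimately show False using g(2) by simp
  qed
  then show ?thesis using f by blast
qed

subsection \<open>The trichotomy\<close>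

text \<open>Stretch \<open>d\<close> as far as possible: \<open>t\<close> is the largest distance it
  reaches. Whatever \<open>t\<close> reaches is reached from \<open>d\<close>, so \<open>t\<close>
  cannot be stretched further.\<close>

lemma tight_of_bnd:
  assumes "bnd d" "0 \<le> d"
  shows "\<exists>t\<ge>d. reach d t \<and> (t = 0 \<or> tight t)"
proof -
  obtain L where L: "\<forall>\<^sub>F h in homs. \<bar>h d - h 0\<bar> \<le> L" using assms(1) bnd_def by blast
  let ?R = "{t. reach d t \<and> 0 \<le> t}"
  have "?R \<subseteq> {0..L}"
  proof
    fix t assume t: "t \<in> ?R"
    then have "\<exists>\<^sub>F h in homs. \<bar>h d - h 0\<bar> = t \<and> \<bar>h d - h 0\<bar> \<le> L"
      unfolding reach_def using L by (intro frequently_eventually_frequently) auto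
    then show "t \<in> {0..L}" using t by (auto dest: frequently_ex)
  qed
  then have fin: "finite ?R" by (rule finite_subset) simp
  define t where "t = Max ?R"
  have "d \<in> ?R" using reach_refl assms by simp
  then have t: "t \<in> ?R" "d \<le> t" unfolding t_def using Max_in[OF fin] Max_ge[OF fin] by blast+
  have "\<forall>\<^sub>F h in homs. \<bar>h t - h 0\<bar> \<le> t"
  proof (rule eventually_reach)
    show "bnd t" using t bnd_trans assms by blast
    fix d' assume "reach t d'" "0 \<le> d'"
    then have "d' \<in> ?R" using t reach_trans by blast
    then show "d' \<le> t" unfolding t_def using fin by simp
  qed
  then show ?thesis using t unfolding tight_def by (intro exI[of _ t]) auto
qed

text \<open>Points congruent modulo \<open>k\<close> are at bounded distance, so each of the
  \<open>k\<close> classes goes into an interval of \<open>2 * B + 1\<close> integers around the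
  image of any of its members.\<close>

lemma bounded_case:
  assumes b: "bnd k" "1 \<le> k"
    and B: "0 \<le> B" "\<And>P. finite P \<Longrightarrow> (\<forall>(x, y)\<in>P. bnd (x - y)) \<Longrightarrow>
      \<exists>\<^sub>F h in homs. \<forall>(x, y)\<in>P. \<bar>h x - h y\<bar> \<le> B" and S: "finite S"
  shows "\<exists>h. hom S h \<and> card (h ` S) \<le> nat k * nat (2 * B + 1)"
proof -
  have mult: "bnd (j * k)" for j
  proof -
    have "bnd (int n * k)" for n
      by (induction n) (auto simp: bnd_0 distrib_right intro: bnd_add b(1))
    from this[of "nat \<bar>j\<bar>"] show ?thesis using bnd_abs[of "j * k"] b(2) by (simp add: abs_mult)
  qed
  define P where "P = {p \<in> S \<times> S. bnd (fst p - snd p)}"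
  have "\<exists>\<^sub>F h in homs. \<forall>(x, y)\<in>P. \<bar>h x - h y\<bar> \<le> B" by (rule B(2)) (use S in \<open>auto simp: P_def\<close>)
  then obtain h where h: "hom S h" "\<forall>(x, y)\<in>P. \<bar>h x - h y\<bar> \<le> B" using S by (rule frequently_homsE)
  define cls where "cls r = {x \<in> S. x mod k = r}" for r
  have "card (h ` cls r) \<le> nat (2 * B + 1)" for r
  proof (cases "cls r = {}")
    case False
    then obtain a where a: "a \<in> cls r" by blast
    have "h x \<in> {h a - B..h a + B}" if "x \<in> cls r" for x
    proof -
      have "k dvd x - a" using that a unfolding cls_def by (auto simp: mod_eq_dvd_iff[symmetric])
      then have "bnd (x - a)" using mult by (metis dvd_def mult.commute)
      then have "(x, a) \<in> P" using that a unfolding P_def cls_def by simp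
      then have "\<bar>h x - h a\<bar> \<le> B" using h(2) by blast
      then show ?thesis by simp linarith
    qed
    then have "h ` cls r \<subseteq> {h a - B..h a + B}" by blast
    then have "card (h ` cls r) \<le> card {h a - B..h a + B}" by (intro card_mono) auto
    then show ?thesis by simp
  qed simp
  then have "(\<Sum>r\<in>{0..<k}. card (h ` cls r)) \<le> (\<Sum>r\<in>{0..<k}. nat (2 * B + 1))" by (intro sum_mono)
  moreover have "S = (\<Union>r\<in>{0..<k}. cls r)" using b(2) unfolding cls_def by auto
  then have "h ` S = (\<Union>r\<in>{0..<k}. h ` cls r)" by (metis image_UN)
  then have "card (h ` S) \<le> (\<Sum>r\<in>{0..<k}. card (h ` cls r))" using card_UN_le[of "{0..<k}" "\<lambda>r. h ` cls r"] by simp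
  ultimately show ?thesis using h(1) by (intro exI[of _ h]) simp
qed

lemma eventually_frozen_pair:
  assumes "\<And>t. tight t \<Longrightarrow> \<forall>\<^sub>F h in homs. \<bar>h t - h 0\<bar> = t" "tight d" "\<bar>x - y\<bar> = d"
  shows "\<forall>\<^sub>F h in homs. \<bar>h x - h y\<bar> = d"
  by (rule eventually_pair[where P="\<lambda>z. z = d", OF assms(1)[OF assms(2)]]) (use assms(3) in simp)

lemma tight_diff:
  assumes fr: "\<And>t. tight t \<Longrightarrow> \<forall>\<^sub>F h in homs. \<bar>h t - h 0\<bar> = t"
    and a: "tight a" and b: "tight b" and "b < a"
  shows "tight (a - b)"
proof -
  have ab: "1 \<le> a" "1 \<le> b" using a b tight_def by auto
  note fz = eventually_frozen_pair[OF fr]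
  have "\<forall>\<^sub>F h in homs. \<bar>h a - h 0\<bar> = a" "\<forall>\<^sub>F h in homs. \<bar>h (2 * a) - h a\<bar> = a"
    by (rule fz[OF _ a]; use ab in simp)+
  moreover have "\<forall>\<^sub>F h in homs. \<bar>h (2 * a) - h 0\<bar> = a + a"
    by (rule fz[OF _ tight_add[OF a a]]) (use ab in simp_all)
  moreover have "\<forall>\<^sub>F h in homs. \<bar>h a - h (a - b)\<bar> = b"
    by (rule fz[OF _ b]) (use ab in simp_all)
  moreover have "\<forall>\<^sub>F h in homs. \<bar>h (2 * a) - h (a - b)\<bar> = a + b"
    by (rule fz[OF _ tight_add[OF a b]]) (use ab in simp_all)
  ultimately have "\<forall>\<^sub>F h in homs. \<bar>h (a - b) - h 0\<bar> \<le> a - b"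
    by eventually_elim (use ab \<open>b < a\<close> in linarith)
  then show ?thesis unfolding tight_def using \<open>b < a\<close> by simp
qed

text \<open>Euclid by subtraction: \<open>tight_diff\<close> allows the least tight distance
  \<open>g\<close> to be subtracted from every larger one.\<close>

lemma frozen_multiples:
  assumes fr: "\<And>t. tight t \<Longrightarrow> \<forall>\<^sub>F h in homs. \<bar>h t - h 0\<bar> = t" and t0: "tight t0"
  shows "\<exists>g\<ge>1. tight g \<and> (\<forall>t. tight t \<longrightarrow> g dvd t)"
proof -
  define G where "G = {t \<in> {1..t0}. tight t}"
  have "t0 \<in> G" unfolding G_def using t0 tight_def by simp
  have "finite G" by (rule finite_subset[of _ "{1..t0}"]) (auto simp: G_def)
  define g where "g = Min G"
  have "g \<in> G" unfolding g_def using \<open>t0 \<in> G\<close> \<open>finite G\<close> by (auto intro: Min_in)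
  then have g: "1 \<le> g" "tight g" unfolding G_def by auto
  have gmin: "g \<le> t" if "tight t" for t
  proof (cases "t \<le> t0")
    case True
    then have "t \<in> G" unfolding G_def using that tight_def by simp
    then show ?thesis unfolding g_def using \<open>finite G\<close> by simp
  next
    case False then show ?thesis using \<open>g \<in> G\<close> unfolding G_def by simp
  qed
  have "g dvd t" if "tight t" "nat t = n" for t n
    using that
  proof (induction n arbitrary: t rule: less_induct)
    case (less n)
    show ?case
    proof (cases "t = g")
      case False
      then have "g < t" using gmin[OF less.prems(1)] by simp
      then have "tight (t - g)" using tight_diff[OF fr less.prems(1) g(2)] by blast
      moreover have "nat (t - g) < n" using less.prems(2) \<open>g < t\<close> g(1) by simp
      ultimately have "g dvd t - g" using less.IH by blast
      then show ?thesis by (metis dvd_diffD dvd_refl diff_add_cancel dvd_add)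
    qed simp
  qed
  then show ?thesis using g by blast
qed

text \<open>A bounded distance can be stretched to its maximum, which is 0 or tight and so a
  multiple of \<open>g\<close>. An unbounded one can be cut at a gap and padded.\<close>

lemma frequently_dvd:
  assumes g: "1 \<le> g" "\<And>t. tight t \<Longrightarrow> g dvd t"
  shows "\<exists>\<^sub>F h in homs. g dvd h x - h y"
proof (cases "bnd (x - y)")
  case True
  then have "bnd \<bar>x - y\<bar>" using bnd_abs by simp
  then obtain t where t: "reach \<bar>x - y\<bar> t" "t = 0 \<or> tight t" using tight_of_bnd[of "\<bar>x - y\<bar>"] by auto
  then have "g dvd t" using g(2) by auto
  from frequently_reach[OF t(1)] show ?thesis
    by (rule frequently_elim1) (use \<open>g dvd t\<close> in \<open>metis dvd_abs_iff\<close>)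
next
  case False
  show ?thesis unfolding frequently_homs
  proof (intro allI impI)
    fix S :: "int set" assume "finite S"
    obtain h z where h: "hom S h" "\<And>p. p \<in> S \<Longrightarrow> h p \<le> z \<Longrightarrow> h p + N < z"
      "(h x \<le> z \<and> z < h y) \<or> (h y \<le> z \<and> z < h x)" using not_bnd_gap[OF False \<open>finite S\<close>] by blast
    \<comment> \<open>The least padding that turns the distance into a multiple of
      \<open>g\<close>.\<close>
    define s where "s = (- \<bar>h x - h y\<bar>) mod g"
    have s: "0 \<le> s" unfolding s_def using g(1) by simp
    have "\<bar>h x - h y\<bar> + s = g * - ((- \<bar>h x - h y\<bar>) div g)"
      using mult_div_mod_eq[of g "- \<bar>h x - h y\<bar>"] unfolding s_def mult_minus_right by linarith
    then have "g dvd \<bar>h x - h y\<bar> + s" by (rule dvdI)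
    moreover have "hom S (\<lambda>x. if h x \<le> z then h x else h x + s)" by (rule hom_split[OF h(1,2) s])
    moreover have "\<bar>(if h x \<le> z then h x else h x + s) - (if h y \<le> z then h y else h y + s)\<bar> = \<bar>h x - h y\<bar> + s"
      using h(3) s by auto
    ultimately show "\<exists>h. hom S h \<and> g dvd h x - h y"
      by (intro exI[of _ "\<lambda>x. if h x \<le> z then h x else h x + s"]) (metis dvd_abs_iff)
  qed
qed

theorem trichotomy:
  "(\<forall>S. finite S \<longrightarrow> (\<exists>h. hom S h \<and> (\<forall>x\<in>S. \<forall>y\<in>S. h x = h y \<or> N < \<bar>h x - h y\<bar>))) \<or>
   (\<exists>B. \<forall>S. finite S \<longrightarrow> (\<exists>h. hom S h \<and> h ` S \<subseteq> {0..B})) \<or>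
   (\<exists>g\<ge>1. (\<forall>S. finite S \<longrightarrow> (\<exists>h. hom S h \<and> (\<forall>x\<in>S. g dvd h x))) \<and>
      (\<forall>m\<ge>0. \<forall>\<^sub>F h in homs. \<bar>h (m * g) - h 0\<bar> = m * g))"
  (is "?spread \<or> ?bounded \<or> ?scaled")
proof (cases "\<exists>d\<ge>1. bnd d")
  case False
  have unb: "\<not> bnd d" if "d \<noteq> 0" for d
  proof -
    have "1 \<le> \<bar>d\<bar>" using that by simp
    then show ?thesis using False bnd_abs[of d] by blast
  qed
  show ?thesis
  proof (cases "\<forall>W. \<exists>D\<ge>W. \<exists>h. hom {- W..D + W} h \<and> h 0 = h D")
    case True
    then have "\<exists>h. hom S h \<and> card (h ` S) \<le> 1" if "finite S" for S
      using merge_all[OF _ unb that] by blast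
    then have ?bounded using bounded_of_card[of 1] by blast
    then show ?thesis by blast
  next
    case False
    then obtain W where W: "\<And>D h. W \<le> D \<Longrightarrow> hom {- W..D + W} h \<Longrightarrow> h 0 \<noteq> h D" by blast
    have "h 0 \<noteq> h D" if "max 0 W \<le> D" "hom {- max 0 W..D + max 0 W} h" for D h
      by (rule W[OF _ hom_mono[OF that(2)]]) (use that(1) in auto)
    then have ?spread using spread_all[of "max 0 W"] unb by (metis max.cobounded1)
    then show ?thesis by blast
  qed
next
  case True
  then obtain d where d: "1 \<le> d" "bnd d" by blast
  show ?thesis
  proof (cases "\<exists>k d. tight k \<and> reach k d \<and> \<not> reach d k")
    case True
    then obtain B where B: "0 \<le> B" "\<And>P. finite P \<Longrightarrow> (\<forall>(x, y)\<in>P. bnd (x - y)) \<Longrightarrow>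
      \<exists>\<^sub>F h in homs. \<forall>(x, y)\<in>P. \<bar>h x - h y\<bar> \<le> B" using shrink_bounded by blast
    have ?bounded
      using bounded_of_card[OF bounded_case[OF d(2,1) B]] by blast
    then show ?thesis by blast
  next
    case False
    then have fr: "\<forall>\<^sub>F h in homs. \<bar>h t - h 0\<bar> = t" if "tight t" for t
      using tight_frozen[OF that] by blast
    obtain t0 where "tight t0" using tight_of_bnd[OF d(2)] d(1) by auto
    then obtain g where g: "1 \<le> g" "tight g" "\<And>t. tight t \<Longrightarrow> g dvd t"
      using frozen_multiples[OF fr] by blast
    have frg: "\<forall>\<^sub>F h in homs. \<bar>h (m * g) - h 0\<bar> = m * g" if "0 \<le> m" for m
    proof (cases "m = 0")
      case False
      then show ?thesis using fr tight_mult[OF g(2)] that by simp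
    qed simp
    have "\<exists>h. hom S h \<and> (\<forall>x\<in>S. g dvd h x)" if S: "finite S" for S
    proof -
      have "\<exists>\<^sub>F h in homs. \<forall>(x, y)\<in>S \<times> S. g dvd h x - h y"
      proof (rule frequently_merge)
        fix x y :: int show "\<exists>\<^sub>F h in homs. g dvd h x - h y" by (rule frequently_dvd[OF g(1,3)])
      next
        fix x y :: int assume "g dvd x - y"
        then obtain m where m: "\<bar>x - y\<bar> = m * g" by (metis dvd_abs_iff dvd_def mult.commute)
        have "0 \<le> m * g" using m by linarith
        then have "0 \<le> m" using g(1) by (simp add: zero_le_mult_iff)
        from frg[OF this] have "\<forall>\<^sub>F h in homs. \<bar>h x - h y\<bar> = m * g"
          by (rule eventually_pair[where P="\<lambda>z. z = m * g"]) (use m \<open>0 \<le> m\<close> g(1) in auto)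
        then show "\<forall>\<^sub>F h in homs. g dvd h x - h y" by eventually_elim (metis dvd_abs_iff dvd_triv_right)
      qed (use S in auto)
      then obtain h where h: "hom S h" "\<forall>(x, y)\<in>S \<times> S. g dvd h x - h y"
        using S by (rule frequently_homsE)
      show ?thesis
      proof (cases "S = {}")
        case False
        then obtain a where "a \<in> S" by blast
        have "hom S (\<lambda>x. h (x + 0) - h a)" by (rule hom_translate[OF h(1)]) simp
        then show ?thesis using h(2) \<open>a \<in> S\<close> by (intro exI[of _ "\<lambda>x. h x - h a"]) auto
      qed (use h in auto)
    qed
    then have ?scaled using frg g(1) by blast
    then show ?thesis by blast
  qed
qed

lemma frozen_orientation:
  assumes fr: "\<And>m. 0 \<le> m \<Longrightarrow> \<forall>\<^sub>F h in homs. \<bar>h m - h 0\<bar> = m"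
    and S: "finite S" "\<not> hom S uminus"
  shows "\<forall>\<^sub>F h in homs. h 1 = h 0 + 1"
proof -
  have pair: "\<forall>\<^sub>F h in homs. \<bar>h x - h y\<bar> = \<bar>x - y\<bar>" for x y
    by (rule eventually_pair[where P="\<lambda>z. z = \<bar>x - y\<bar>", OF fr]) simp_all
  have "\<forall>\<^sub>F h in homs. \<bar>h 1 - h 0\<bar> = 1"
    using pair[of 1 0] by simp
  moreover have "\<forall>\<^sub>F h in homs. \<forall>x\<in>S. \<bar>h x - h 0\<bar> = \<bar>x - 0\<bar> \<and> \<bar>h x - h 1\<bar> = \<bar>x - 1\<bar>"
    by (intro eventually_ball_finite[OF S(1)] ballI eventually_conj pair)
  moreover have "\<forall>\<^sub>F h in homs. hom S h" unfolding eventually_homs using S(1) by blast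
  ultimately show ?thesis
  proof eventually_elim
    case (elim h)
    show ?case
    proof (rule ccontr)
      assume "\<not> ?case"
      then have h1: "h 1 = h 0 - 1" using elim(1) by linarith
      have flip: "h x = h 0 - x" if "x \<in> S" for x
      proof -
        have "\<bar>h x - h 0\<bar> = \<bar>x\<bar>" "\<bar>h x - (h 0 - 1)\<bar> = \<bar>x - 1\<bar>"
          using bspec[OF elim(2) that] unfolding h1 by simp_all
        then show ?thesis by linarith
      qed
      have "hom S uminus" by (rule hom_capeq[OF elim(3)]) (simp add: flip capeq_def)
      then show False using S(2) by blast
    qed
  qed
qed

end

section \<open>Formulas over the integers\<close>

lemma sat_cong: "(\<And>x. x \<in> fv p \<Longrightarrow> v x = w x) \<Longrightarrow> sat D I p v = sat D I p w"
proof (induction p arbitrary: v w)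
  case (Atom s xs)
  then have "map v xs = map w xs" by simp
  then show ?case by (simp only: sat.simps)
next
  case (Eq x y)
  then have "v x = w x" "v y = w y" by simp_all
  then show ?case by (simp only: sat.simps)
next
  case (Neg p)
  then show ?case by (metis fv.simps(3) sat.simps(3))
next
  case (Conj p q)
  then show ?case by (metis UnCI fv.simps(4) sat.simps(4))
next
  case (Ex x p)
  have "sat D I p (v(x := a)) = sat D I p (w(x := a))" for a
    by (rule Ex.IH) (use Ex.prems in auto)
  then show ?case by simp
qed

lemma mem_defined_by_UNIV:
  assumes "fv p \<subseteq> {..<n}"
  shows "xs \<in> defined_by UNIV I n p \<longleftrightarrow> length xs = n \<and> sat UNIV I p (\<lambda>i. xs ! i)"
proof -
  have "sat UNIV I p v = sat UNIV I p (\<lambda>i. xs ! i)" if "map v [0..<n] = xs" for v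
    by (rule sat_cong) (use that assms in \<open>auto simp: subset_iff\<close>)
  moreover have "map (\<lambda>i. xs ! i) [0..<n] = xs" if "length xs = n"
    using that map_nth by blast
  ultimately show ?thesis unfolding defined_by_def by auto
qed

lemma capeq_sym: "capeq N a b \<Longrightarrow> capeq N b a"
  unfolding capeq_def by auto

lemma capeq_antimono: "capeq N a b \<Longrightarrow> M \<le> N \<Longrightarrow> capeq M a b"
  unfolding capeq_def by auto

text \<open>The back-and-forth step. If \<open>a\<close> is within \<open>N\<close> of some point,
  its offset is copied; otherwise \<open>b\<close> is placed next to the image of the nearest point
  below, or below everything.\<close>

lemma capeq_extend:
  fixes v w :: "'i \<Rightarrow> int"
  assumes F: "finite F" and N: "0 \<le> N"
    and cap: "\<And>x y. x \<in> F \<Longrightarrow> y \<in> F \<Longrightarrow> capeq (2 * N + 1) (v x - v y) (w x - w y)"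
  shows "\<exists>b. \<forall>y\<in>F. capeq N (a - v y) (b - w y) \<and> capeq N (v y - a) (w y - b)"
proof -
  have *: "capeq N (- p) (- q)" if "capeq N p q" for p q using that unfolding capeq_def by auto
  have "\<exists>b. \<forall>y\<in>F. capeq N (a - v y) (b - w y)"
  proof (cases "\<exists>y\<in>F. \<bar>a - v y\<bar> \<le> N")
    case True
    then obtain z where z: "z \<in> F" "\<bar>a - v z\<bar> \<le> N" by blast
    have "capeq N (a - v y) (w z + (a - v z) - w y)" if "y \<in> F" for y
      using cap[OF z(1) that] z(2) N unfolding capeq_def by auto
    then show ?thesis by blast
  next
    case far: False
    define Lo where "Lo = {y \<in> F. v y < a}"
    show ?thesis
    proof (cases "Lo = {}")
      case True
      have "capeq N (a - v y) (Min (w ` F) - N - 1 - w y)" if "y \<in> F" for y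
      proof -
        have "Min (w ` F) \<le> w y" using F that by simp
        moreover have "\<not> v y < a" using True that unfolding Lo_def by blast
        moreover have "\<not> \<bar>a - v y\<bar> \<le> N" using far that by blast
        ultimately show ?thesis unfolding capeq_def by linarith
      qed
      then show ?thesis by blast
    next
      case False
      have "finite Lo" using F unfolding Lo_def by simp
      then have "Max (v ` Lo) \<in> v ` Lo" using False by (intro Max_in) auto
      then obtain z where z: "z \<in> Lo" "v z = Max (v ` Lo)" by auto
      have zmax: "v y \<le> v z" if "y \<in> Lo" for y using z(2) that \<open>finite Lo\<close> by simp
      have zF: "z \<in> F" "v z < a" using z(1) unfolding Lo_def by auto
      \<comment> \<open>The origin of \<open>2 * N + 1\<close>: a point \<open>y\<close> above
        \<open>a\<close> has \<open>v y - v z \<ge> 2 * N + 2\<close>, so \<open>w y - w z\<close>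
        is as large, leaving room for a value more than \<open>N\<close> from both sides.\<close>
      have "capeq N (a - v y) (w z + N + 1 - w y)" if y: "y \<in> F" for y
      proof -
        have fy: "\<not> \<bar>a - v y\<bar> \<le> N" "\<not> \<bar>a - v z\<bar> \<le> N" using far y zF by blast+
        have c: "capeq (2 * N + 1) (v z - v y) (w z - w y)" using cap[OF zF(1) y] .
        show ?thesis
        proof (cases "v y < a")
          case True
          then have "v y \<le> v z" using zmax y unfolding Lo_def by blast
          then show ?thesis using c fy True N unfolding capeq_def by linarith
        next
          case False
          then show ?thesis using c fy zF(2) N unfolding capeq_def by linarith
        qed
      qed
      then show ?thesis by blast
    qed
  qed
  then obtain b where b: "\<And>y. y \<in> F \<Longrightarrow> capeq N (a - v y) (b - w y)" by blast
  have "capeq N (v y - a) (w y - b)" if "y \<in> F" for y using *[OF b[OF that]] by simp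
  then show ?thesis using b by blast
qed

lemma finite_fv: "finite (fv p)"
  by (induction p) auto

text \<open>Quantifier elimination for \<open>(\<int>; <)\<close>, semantically: each quantifier roughly doubles the
  threshold above which differences cannot be told apart.\<close>

lemma sat_threshold:
  "wf_fm lt_ar p \<Longrightarrow> \<exists>N\<ge>0. \<forall>v w :: nat \<Rightarrow> int.
     (\<forall>x\<in>fv p. \<forall>y\<in>fv p. capeq N (v x - v y) (w x - w y)) \<longrightarrow>
     sat UNIV lt_rel p v = sat UNIV lt_rel p w"
proof (induction p)
  case (Atom s xs)
  then have "length xs = Suc (Suc 0)" by (simp add: lt_ar_def)
  then obtain x y where xs: "xs = [x, y]" by (auto simp: length_Suc_conv)
  show ?case unfolding xs
    by (intro exI[of _ 0]) (auto simp: lt_rel_def capeq_def)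
next
  case (Eq x y)
  show ?case by (intro exI[of _ 0]) (auto simp: capeq_def)
next
  case (Neg p)
  then show ?case by auto
next
  case (Conj p q)
  then obtain N M where NM: "0 \<le> N" "0 \<le> M"
    "\<And>v w :: nat \<Rightarrow> int. (\<forall>x\<in>fv p. \<forall>y\<in>fv p. capeq N (v x - v y) (w x - w y)) \<Longrightarrow>
       sat UNIV lt_rel p v = sat UNIV lt_rel p w"
    "\<And>v w :: nat \<Rightarrow> int. (\<forall>x\<in>fv q. \<forall>y\<in>fv q. capeq M (v x - v y) (w x - w y)) \<Longrightarrow>
       sat UNIV lt_rel q v = sat UNIV lt_rel q w" by auto
  have "sat UNIV lt_rel (Conj p q) v = sat UNIV lt_rel (Conj p q) w"
    if *: "\<forall>x\<in>fv (Conj p q). \<forall>y\<in>fv (Conj p q). capeq (max N M) (v x - v y) (w x - w y)" for v w :: "nat \<Rightarrow> int"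
  proof -
    have "sat UNIV lt_rel p v = sat UNIV lt_rel p w"
      by (rule NM(3)) (use * capeq_antimono in fastforce)
    moreover have "sat UNIV lt_rel q v = sat UNIV lt_rel q w"
      by (rule NM(4)) (use * capeq_antimono in fastforce)
    ultimately show ?thesis by simp
  qed
  then show ?case using NM(1) by (intro exI[of _ "max N M"]) auto
next
  case (Ex x p)
  then obtain N where N: "0 \<le> N"
    "\<And>v w :: nat \<Rightarrow> int. (\<forall>x\<in>fv p. \<forall>y\<in>fv p. capeq N (v x - v y) (w x - w y)) \<Longrightarrow>
       sat UNIV lt_rel p v = sat UNIV lt_rel p w" by auto
  have imp: "sat UNIV lt_rel (Ex x p) w"
    if *: "\<forall>x'\<in>fv (Ex x p). \<forall>y\<in>fv (Ex x p). capeq (2 * N + 1) (v x' - v y) (w x' - w y)"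
      and sat: "sat UNIV lt_rel (Ex x p) v" for v w :: "nat \<Rightarrow> int"
  proof -
    obtain a where a: "sat UNIV lt_rel p (v(x := a))" using sat by auto
    obtain b where b: "\<forall>y\<in>fv p - {x}. capeq N (a - v y) (b - w y) \<and> capeq N (v y - a) (w y - b)"
      using capeq_extend[of "fv p - {x}" N v w a] * N(1) finite_fv[of p] by auto
    have c: "capeq N (v x' - v y) (w x' - w y)" if "x' \<in> fv p - {x}" "y \<in> fv p - {x}" for x' y
      by (rule capeq_antimono[of "2 * N + 1"]) (use * that N(1) in auto)
    have "capeq N ((v(x := a)) x' - (v(x := a)) y) ((w(x := b)) x' - (w(x := b)) y)"
      if "x' \<in> fv p" "y \<in> fv p" for x' y
      using b c[of x' y] that by (cases "x' = x"; cases "y = x") (auto simp: capeq_def[of N 0 0])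
    then have "sat UNIV lt_rel p (v(x := a)) = sat UNIV lt_rel p (w(x := b))" by (intro N(2)) blast
    then show ?thesis using a by auto
  qed
  show ?case
  proof (intro exI[of _ "2 * N + 1"] conjI allI impI)
    fix v w :: "nat \<Rightarrow> int"
    assume *: "\<forall>x'\<in>fv (Ex x p). \<forall>y\<in>fv (Ex x p). capeq (2 * N + 1) (v x' - v y) (w x' - w y)"
    then have "\<forall>x'\<in>fv (Ex x p). \<forall>y\<in>fv (Ex x p). capeq (2 * N + 1) (w x' - w y) (v x' - v y)"
      using capeq_sym by blast
    then show "sat UNIV lt_rel (Ex x p) v = sat UNIV lt_rel (Ex x p) w" using imp * by blast
  qed (use N(1) in simp)
qed

text \<open>One implication is enough, as \<open>capeq\<close> is symmetric. Together with fixed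
  arities this is the working form of definability from the order of the integers.\<close>

definition threshold :: "int \<Rightarrow> ('s \<Rightarrow> int list set) \<Rightarrow> bool" where
  "threshold N \<Gamma> \<longleftrightarrow> 0 \<le> N \<and> (\<forall>s xs ys. length xs = length ys \<longrightarrow>
     (\<forall>i<length xs. \<forall>j<length xs. capeq N (xs ! i - xs ! j) (ys ! i - ys ! j)) \<longrightarrow>
     xs \<in> \<Gamma> s \<longrightarrow> ys \<in> \<Gamma> s)"

lemma thresholdD:
  assumes "threshold N \<Gamma>" "map f zs \<in> \<Gamma> s"
    "\<And>x y. x \<in> set zs \<Longrightarrow> y \<in> set zs \<Longrightarrow> capeq N (f x - f y) (g x - g y)"
  shows "map g zs \<in> \<Gamma> s"
proof -
  have "\<forall>i<length (map f zs). \<forall>j<length (map f zs). capeq N (map f zs ! i - map f zs ! j) (map g zs ! i - map g zs ! j)"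
    using assms(3) by simp
  moreover have "length (map f zs) = length (map g zs)" by simp
  ultimately show ?thesis using assms(1,2) unfolding threshold_def by blast
qed

text \<open>Finiteness of the signature allows one threshold for all relations, the sum of the
  individual ones.\<close>

lemma order_reduct_threshold:
  fixes \<Gamma> :: "'s::finite \<Rightarrow> int list set"
  assumes "order_reduct ar \<Gamma>"
  shows "\<exists>N. threshold N \<Gamma>"
proof -
  have "\<exists>N\<ge>0. \<forall>xs ys. length xs = length ys \<longrightarrow>
     (\<forall>i<length xs. \<forall>j<length xs. capeq N (xs ! i - xs ! j) (ys ! i - ys ! j)) \<longrightarrow>
     xs \<in> \<Gamma> s \<longrightarrow> ys \<in> \<Gamma> s" for s
  proof -
    obtain p where p: "wf_fm lt_ar p" "fv p \<subseteq> {..<ar s}" "\<Gamma> s = defined_by UNIV lt_rel (ar s) p"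
      using assms unfolding order_reduct_def fo_definable_def by blast
    obtain N where N: "N \<ge> 0" "\<And>v w :: nat \<Rightarrow> int.
     (\<forall>x\<in>fv p. \<forall>y\<in>fv p. capeq N (v x - v y) (w x - w y)) \<Longrightarrow>
     sat UNIV lt_rel p v = sat UNIV lt_rel p w" using sat_threshold[OF p(1)] by blast
    have "ys \<in> \<Gamma> s" if len: "length xs = length ys" and
      cap: "\<forall>i<length xs. \<forall>j<length xs. capeq N (xs ! i - xs ! j) (ys ! i - ys ! j)" and mem: "xs \<in> \<Gamma> s" for xs ys
    proof -
      have xs: "length xs = ar s" "sat UNIV lt_rel p (\<lambda>i. xs ! i)"
        using mem mem_defined_by_UNIV[OF p(2)] p(3) by auto
      have "sat UNIV lt_rel p (\<lambda>i. xs ! i) = sat UNIV lt_rel p (\<lambda>i. ys ! i)"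
        by (rule N(2)) (use cap p(2) xs(1) in auto)
      then show ?thesis using xs len mem_defined_by_UNIV[OF p(2)] p(3) by auto
    qed
    then show ?thesis using N(1) by blast
  qed
  then obtain N where N: "\<And>s. 0 \<le> N s" "\<And>s xs ys. length xs = length ys \<Longrightarrow>
     (\<forall>i<length xs. \<forall>j<length xs. capeq (N s) (xs ! i - xs ! j) (ys ! i - ys ! j)) \<Longrightarrow>
     xs \<in> \<Gamma> s \<Longrightarrow> ys \<in> \<Gamma> s" by metis
  have le: "N s \<le> (\<Sum>s\<in>UNIV. N s)" for s by (rule member_le_sum) (use N(1) in auto)
  have "threshold (\<Sum>s\<in>UNIV. N s) \<Gamma>"
    unfolding threshold_def
  proof (intro conjI allI impI)
    fix s and xs ys :: "int list"
    assume *: "length xs = length ys"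
      "\<forall>i<length xs. \<forall>j<length xs. capeq (\<Sum>s\<in>UNIV. N s) (xs ! i - xs ! j) (ys ! i - ys ! j)" "xs \<in> \<Gamma> s"
    show "ys \<in> \<Gamma> s"
      by (rule N(2)[OF *(1) _ *(3)]) (use *(2) capeq_antimono[OF _ le] in blast)
  qed (simp add: N(1) sum_nonneg)
  then show ?thesis by blast
qed

lemma order_reduct_length: "order_reduct ar \<Gamma> \<Longrightarrow> xs \<in> \<Gamma> s \<Longrightarrow> length xs = ar s"
  unfolding order_reduct_def fo_definable_def defined_by_def by blast

section \<open>First-order definability from finitely many tests\<close>

text \<open>A relation closed under having the same truth values on \<open>T\<close> is a Boolean
  combination of \<open>T\<close>. The induction splits according to the truth value of the new
  test.\<close>

lemma fo_definable_of_tests: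
  assumes "finite T" "\<And>p. p \<in> T \<Longrightarrow> wf_fm ar p \<and> fv p \<subseteq> {..<n}"
    and "\<And>xs. xs \<in> R \<Longrightarrow> length xs = n"
    and "\<And>xs ys. xs \<in> R \<Longrightarrow> length ys = n \<Longrightarrow>
      (\<And>p. p \<in> T \<Longrightarrow> sat UNIV I p (\<lambda>i. xs ! i) = sat UNIV I p (\<lambda>i. ys ! i)) \<Longrightarrow> ys \<in> R"
  shows "fo_definable UNIV I ar n R"
proof -
  have "\<exists>p. wf_fm ar p \<and> fv p \<subseteq> {..<n} \<and> (\<forall>xs. length xs = n \<longrightarrow> (xs \<in> R \<longleftrightarrow> sat UNIV I p (\<lambda>i. xs ! i)))"
    using assms
  proof (induction T arbitrary: R)
    case empty
    \<comment> \<open>A closed true formula, so that \<open>n = 0\<close>, where no variable may be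
      free, is covered.\<close>
    let ?t = "Ex 0 (Eq 0 0)"
    show ?case
    proof (cases "R = {}")
      case True
      then show ?thesis by (intro exI[of _ "Neg ?t"]) simp
    next
      case False
      then obtain zs where "zs \<in> R" by blast
      then have "ys \<in> R" if "length ys = n" for ys using empty.prems(3) that by blast
      then show ?thesis by (intro exI[of _ ?t]) simp
    qed
  next
    case (insert t T)
    define R' where "R' b = {xs. length xs = n \<and> (\<exists>ys\<in>R. sat UNIV I t (\<lambda>i. ys ! i) = b \<and>
       (\<forall>p\<in>T. sat UNIV I p (\<lambda>i. ys ! i) = sat UNIV I p (\<lambda>i. xs ! i)))}" for b
    have "\<exists>p. wf_fm ar p \<and> fv p \<subseteq> {..<n} \<and> (\<forall>xs. length xs = n \<longrightarrow> (xs \<in> R' b \<longleftrightarrow> sat UNIV I p (\<lambda>i. xs ! i)))" for b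
      by (rule insert.IH) (use insert.prems(1) in \<open>auto simp: R'_def\<close>)
    then obtain q where q: "\<And>b. wf_fm ar (q b) \<and> fv (q b) \<subseteq> {..<n}"
      "\<And>b xs. length xs = n \<Longrightarrow> xs \<in> R' b \<longleftrightarrow> sat UNIV I (q b) (\<lambda>i. xs ! i)" by metis
    have R: "xs \<in> R \<longleftrightarrow> xs \<in> R' (sat UNIV I t (\<lambda>i. xs ! i))" if "length xs = n" for xs
    proof
      assume "xs \<in> R" then show "xs \<in> R' (sat UNIV I t (\<lambda>i. xs ! i))" unfolding R'_def using that by blast
    next
      assume "xs \<in> R' (sat UNIV I t (\<lambda>i. xs ! i))"
      then obtain ys where "ys \<in> R" "\<forall>p\<in>insert t T. sat UNIV I p (\<lambda>i. ys ! i) = sat UNIV I p (\<lambda>i. xs ! i)"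
        unfolding R'_def by auto
      then show "xs \<in> R" using insert.prems(3) that by blast
    qed
    show ?case
    proof (intro exI[of _ "Neg (Conj (Neg (Conj t (q True))) (Neg (Conj (Neg t) (q False))))"] conjI allI impI)
      fix xs :: "'b list" assume len: "length xs = n"
      show "xs \<in> R \<longleftrightarrow> sat UNIV I (Neg (Conj (Neg (Conj t (q True))) (Neg (Conj (Neg t) (q False))))) (\<lambda>i. xs ! i)"
        using R[OF len] q(2)[OF len] by (cases "sat UNIV I t (\<lambda>i. xs ! i)") auto
    qed (use q(1) insert.prems(1)[of t] in auto)
  qed
  then obtain p where p: "wf_fm ar p" "fv p \<subseteq> {..<n}"
    "\<And>xs. length xs = n \<Longrightarrow> xs \<in> R \<longleftrightarrow> sat UNIV I p (\<lambda>i. xs ! i)" by blast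
  have "R = defined_by UNIV I n p"
    using mem_defined_by_UNIV[OF p(2), of _ I] p(3) assms(3) by blast
  then show ?thesis unfolding fo_definable_def using p by blast
qed

lemma lt_rel_pair [simp]: "[a, b] \<in> lt_rel u \<longleftrightarrow> a < b"
  unfolding lt_rel_def by simp

text \<open>A chain of \<open>c\<close> intermediate points, which in the integers expresses a
  difference greater than \<open>c\<close>. The bound variable \<open>Suc (max x y)\<close> is fresh
  for both ends.\<close>

fun diff_gt :: "nat \<Rightarrow> nat \<Rightarrow> nat \<Rightarrow> unit fm" where
  "diff_gt 0 x y = Atom () [x, y]"
| "diff_gt (Suc c) x y = Ex (Suc (max x y)) (Conj (Atom () [x, Suc (max x y)]) (diff_gt c (Suc (max x y)) y))"

lemma wf_diff_gt: "wf_fm lt_ar (diff_gt c x y)"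
  by (induction c x y rule: diff_gt.induct) (auto simp: lt_ar_def)

lemma fv_diff_gt: "fv (diff_gt c x y) = {x, y}"
proof (induction c x y rule: diff_gt.induct)
  case (2 c x y)
  have "x \<noteq> Suc (max x y)" "y \<noteq> Suc (max x y)" by linarith+
  then show ?case unfolding diff_gt.simps fv.simps 2 by auto
qed auto

lemma sat_diff_gt: "sat UNIV lt_rel (diff_gt c x y) v \<longleftrightarrow> int c < v y - v x"
proof (induction c x y arbitrary: v rule: diff_gt.induct)
  case (1 x y)
  show ?case by simp
next
  case (2 c x y)
  have ne: "x \<noteq> Suc (max x y)" "y \<noteq> Suc (max x y)" by linarith+
  have "sat UNIV lt_rel (diff_gt (Suc c) x y) v \<longleftrightarrow> (\<exists>a. v x < a \<and> int c < v y - a)"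
    using ne by (simp add: 2)
  also have "\<dots> \<longleftrightarrow> int (Suc c) < v y - v x"
  proof
    assume "int (Suc c) < v y - v x"
    then show "\<exists>a. v x < a \<and> int c < v y - a" by (intro exI[of _ "v x + 1"]) auto
  qed auto
  finally show ?case .
qed

text \<open>The tests "difference greater than \<open>c\<close>" for
  \<open>0 \<le> c \<le> N\<close> determine every difference up to \<open>capeq N\<close>.\<close>

lemma threshold_order_reduct:
  fixes \<Gamma> :: "'s \<Rightarrow> int list set"
  assumes N: "threshold N \<Gamma>" and len: "\<And>s xs. xs \<in> \<Gamma> s \<Longrightarrow> length xs = ar s"
  shows "order_reduct ar \<Gamma>"
  unfolding order_reduct_def
proof
  fix s
  define T where "T = (\<lambda>(c, i, j). diff_gt c i j) ` ({..nat N} \<times> {..<ar s} \<times> {..<ar s})"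
  have N0: "0 \<le> N" using N threshold_def by blast
  show "fo_definable UNIV lt_rel lt_ar (ar s) (\<Gamma> s)"
  proof (rule fo_definable_of_tests[of T])
    fix xs ys :: "int list" assume xs: "xs \<in> \<Gamma> s" and ys: "length ys = ar s" and
      tests: "\<And>p. p \<in> T \<Longrightarrow> sat UNIV lt_rel p (\<lambda>i. xs ! i) = sat UNIV lt_rel p (\<lambda>i. ys ! i)"
    have gt: "c < xs ! j - xs ! i \<longleftrightarrow> c < ys ! j - ys ! i" if "i < ar s" "j < ar s" "0 \<le> c" "c \<le> N" for i j c
    proof -
      have "diff_gt (nat c) i j \<in> T" 
        unfolding T_def using that
        by (intro image_eqI[of _ _ "(nat c, i, j)"]) (simp_all add: nat_mono)
      from tests[OF this] show ?thesis using that(3) unfolding sat_diff_gt by simp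
    qed
    have "capeq N (xs ! i - xs ! j) (ys ! i - ys ! j)" if ij: "i < ar s" "j < ar s" for i j
    proof -
      have half: "capeq N (xs ! i - xs ! j) (ys ! i - ys ! j)"
        if ij: "i < ar s" "j < ar s" and pos: "xs ! j < xs ! i" for i j
      proof (cases "xs ! i - xs ! j \<le> N")
        case True
        then show ?thesis
          using gt[OF ij(2,1), of "xs ! i - xs ! j"] gt[OF ij(2,1), of "xs ! i - xs ! j - 1"] pos
          unfolding capeq_def by auto
      next
        case False
        then show ?thesis using gt[OF ij(2,1), of N] N0 unfolding capeq_def by auto
      qed
      consider "xs ! j < xs ! i" | "xs ! i < xs ! j" | "xs ! i = xs ! j" by linarith
      then show ?thesis
      proof cases
        case 1 then show ?thesis using half ij by blast
      next
        case 2 then show ?thesis using half[OF ij(2,1)] unfolding capeq_def by linarith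
      next
        case 3 then show ?thesis using gt[OF ij, of 0] gt[OF ij(2,1), of 0] N0 unfolding capeq_def by auto
      qed
    qed
    then show "ys \<in> \<Gamma> s" using N xs ys len[OF xs] unfolding threshold_def by metis
  qed (auto simp: T_def wf_diff_gt fv_diff_gt len)
qed

section \<open>Transfer and construction of primitive positive formulas\<close>

text \<open>\<open>W\<close> collects the values in the atoms and the existential witnesses. Without
  negation, satisfaction depends only on tuples within \<open>W\<close> that lie in the relations,
  and \<open>h\<close> maps these to tuples of \<open>J\<close>.\<close>

lemma csp_witnesses:
  assumes "is_pp p" "sat D I p v" "range v \<subseteq> D"
  shows "\<exists>W. finite W \<and> W \<subseteq> D \<and> (\<forall>h. h ` W \<subseteq> E \<longrightarrow>
     (\<forall>s xs. xs \<in> I s \<longrightarrow> set xs \<subseteq> W \<longrightarrow> map h xs \<in> J s) \<longrightarrow> sat E J p (\<lambda>x. h (v x)))"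
  using assms
proof (induction p arbitrary: v)
  case (Atom s xs)
  show ?case
  proof (intro exI[of _ "v ` set xs"] conjI allI impI)
    fix h assume "\<forall>s' ys. ys \<in> I s' \<longrightarrow> set ys \<subseteq> v ` set xs \<longrightarrow> map h ys \<in> J s'"
    moreover have "map v xs \<in> I s" using Atom.prems by simp
    ultimately have "map h (map v xs) \<in> J s" by (metis order_refl set_map)
    then show "sat E J (Atom s xs) (\<lambda>x. h (v x))" by (simp add: comp_def)
  qed (use Atom.prems in auto)
next
  case (Conj p q)
  obtain W where W: "finite W" "W \<subseteq> D" "\<And>h. h ` W \<subseteq> E \<Longrightarrow>
     (\<forall>s xs. xs \<in> I s \<longrightarrow> set xs \<subseteq> W \<longrightarrow> map h xs \<in> J s) \<Longrightarrow> sat E J p (\<lambda>x. h (v x))"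
    using Conj.IH(1)[of v] Conj.prems by auto
  obtain W' where W': "finite W'" "W' \<subseteq> D" "\<And>h. h ` W' \<subseteq> E \<Longrightarrow>
     (\<forall>s xs. xs \<in> I s \<longrightarrow> set xs \<subseteq> W' \<longrightarrow> map h xs \<in> J s) \<Longrightarrow> sat E J q (\<lambda>x. h (v x))"
    using Conj.IH(2)[of v] Conj.prems by auto
  show ?case
  proof (intro exI[of _ "W \<union> W'"] conjI allI impI)
    fix h assume h: "h ` (W \<union> W') \<subseteq> E" "\<forall>s xs. xs \<in> I s \<longrightarrow> set xs \<subseteq> W \<union> W' \<longrightarrow> map h xs \<in> J s"
    have "sat E J p (\<lambda>x. h (v x))" by (rule W(3)) (use h in blast)+
    moreover have "sat E J q (\<lambda>x. h (v x))" by (rule W'(3)) (use h in blast)+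
    ultimately show "sat E J (Conj p q) (\<lambda>x. h (v x))" by simp
  qed (use W W' in auto)
next
  case (Ex x p)
  then obtain a where a: "a \<in> D" "sat D I p (v(x := a))" by auto
  have "range (v(x := a)) \<subseteq> D" using a Ex.prems by auto
  then obtain W where W: "finite W" "W \<subseteq> D" "\<And>h. h ` W \<subseteq> E \<Longrightarrow>
     (\<forall>s xs. xs \<in> I s \<longrightarrow> set xs \<subseteq> W \<longrightarrow> map h xs \<in> J s) \<Longrightarrow> sat E J p (\<lambda>y. h ((v(x := a)) y))"
    using Ex.IH[OF _ a(2)] Ex.prems by auto
  show ?case
  proof (intro exI[of _ "insert a W"] conjI allI impI)
    fix h assume h: "h ` insert a W \<subseteq> E" "\<forall>s xs. xs \<in> I s \<longrightarrow> set xs \<subseteq> insert a W \<longrightarrow> map h xs \<in> J s"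
    have "sat E J p (\<lambda>y. h ((v(x := a)) y))" by (rule W(3)) (use h in blast)+
    moreover have "(\<lambda>y. h ((v(x := a)) y)) = (\<lambda>y. h (v y))(x := h a)" by auto
    ultimately show "sat E J (Ex x p) (\<lambda>x. h (v x))" using h(1) by auto
  qed (use W a in auto)
qed auto

lemma holds_transfer:
  assumes "pp_sentence ar p" "holds D I p" "D \<noteq> {}"
    and maps: "\<And>W. finite W \<Longrightarrow> W \<subseteq> D \<Longrightarrow> \<exists>h. h ` W \<subseteq> E \<and>
      (\<forall>s xs. xs \<in> I s \<longrightarrow> set xs \<subseteq> W \<longrightarrow> map h xs \<in> J s)"
  shows "holds E J p"
proof -
  have p: "is_pp p" "fv p = {}" using assms(1) unfolding pp_sentence_def by auto
  obtain a where a: "a \<in> D" using assms(3) by blast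
  have "sat D I p (\<lambda>_. a)" using assms(2) a unfolding holds_def by auto
  from csp_witnesses[OF p(1) this, of E J] a obtain W where W: "finite W" "W \<subseteq> D"
    "\<And>h. h ` W \<subseteq> E \<Longrightarrow> (\<forall>s xs. xs \<in> I s \<longrightarrow> set xs \<subseteq> W \<longrightarrow> map h xs \<in> J s) \<Longrightarrow> sat E J p (\<lambda>x. h a)"
    by auto
  obtain h where "h ` W \<subseteq> E" "\<forall>s xs. xs \<in> I s \<longrightarrow> set xs \<subseteq> W \<longrightarrow> map h xs \<in> J s"
    using maps[OF W(1,2)] by blast
  then have "sat E J p (\<lambda>x. h a)" by (rule W(3))
  moreover have "sat E J p v = sat E J p (\<lambda>x. h a)" for v by (rule sat_cong) (use p in auto)
  ultimately show ?thesis unfolding holds_def by blast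
qed

text \<open>The empty conjunction is rendered as \<open>Eq 0 0\<close>, which accounts for the
  variable 0 in the bound on free variables.\<close>

lemma pp_conj:
  assumes "finite \<Phi>" "\<And>p. p \<in> \<Phi> \<Longrightarrow> is_pp p \<and> wf_fm ar p"
  shows "\<exists>q. is_pp q \<and> wf_fm ar q \<and> fv q \<subseteq> {0} \<union> (\<Union>p\<in>\<Phi>. fv p) \<and>
    (\<forall>v. sat D I q v \<longleftrightarrow> (\<forall>p\<in>\<Phi>. sat D I p v))"
  using assms
proof (induction \<Phi>)
  case empty
  show ?case by (intro exI[of _ "Eq 0 0"]) simp
next
  case (insert p \<Phi>)
  then obtain q where "is_pp q \<and> wf_fm ar q \<and> fv q \<subseteq> {0} \<union> (\<Union>p\<in>\<Phi>. fv p) \<and>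
    (\<forall>v. sat D I q v \<longleftrightarrow> (\<forall>p\<in>\<Phi>. sat D I p v))" by auto
  then show ?case using insert.prems by (intro exI[of _ "Conj p q"]) auto
qed

lemma pp_exists:
  assumes "finite V" "is_pp p" "wf_fm ar p"
  shows "\<exists>q. is_pp q \<and> wf_fm ar q \<and> fv q = fv p - V \<and>
    (\<forall>v. sat UNIV I q v \<longleftrightarrow> (\<exists>w. (\<forall>i. i \<notin> V \<longrightarrow> w i = v i) \<and> sat UNIV I p w))"
  using assms(1)
proof (induction V)
  case empty
  have "w = v" if "\<forall>i. w i = v i" for w v :: "nat \<Rightarrow> 'b" using that by blast
  then show ?case using assms by (intro exI[of _ p]) auto
next
  case (insert x V)
  then obtain q where q: "is_pp q" "wf_fm ar q" "fv q = fv p - V"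
    "\<And>v. sat UNIV I q v \<longleftrightarrow> (\<exists>w. (\<forall>i. i \<notin> V \<longrightarrow> w i = v i) \<and> sat UNIV I p w)" by blast
  have "sat UNIV I (Ex x q) v \<longleftrightarrow> (\<exists>w. (\<forall>i. i \<notin> insert x V \<longrightarrow> w i = v i) \<and> sat UNIV I p w)" for v
  proof
    assume "sat UNIV I (Ex x q) v"
    then obtain a w where "\<forall>i. i \<notin> V \<longrightarrow> w i = (v(x := a)) i" "sat UNIV I p w" using q(4) by auto
    then show "\<exists>w. (\<forall>i. i \<notin> insert x V \<longrightarrow> w i = v i) \<and> sat UNIV I p w"
      by (intro exI[of _ w]) auto
  next
    assume "\<exists>w. (\<forall>i. i \<notin> insert x V \<longrightarrow> w i = v i) \<and> sat UNIV I p w"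
    then obtain w where w: "\<forall>i. i \<notin> insert x V \<longrightarrow> w i = v i" "sat UNIV I p w" by blast
    then have "\<forall>i. i \<notin> V \<longrightarrow> w i = (v(x := w x)) i" by simp
    then have "sat UNIV I q (v(x := w x))" using q(4) w(2) by blast
    then show "sat UNIV I (Ex x q) v" by auto
  qed
  then show ?case using q by (intro exI[of _ "Ex x q"]) auto
qed

definition preserves :: "('s \<Rightarrow> int list set) \<Rightarrow> int set \<Rightarrow> (int \<Rightarrow> int) \<Rightarrow> bool" where
  "preserves \<Gamma> S h \<longleftrightarrow> (\<forall>s xs. xs \<in> \<Gamma> s \<longrightarrow> set xs \<subseteq> S \<longrightarrow> map h xs \<in> \<Gamma> s)"

text \<open>The diagram of a finite substructure, with all elements but \<open>0\<close> and \<open>m\<close> quantified.\<close>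

lemma pp_definable_preserves:
  fixes \<Gamma> :: "'s::finite \<Rightarrow> int list set"
  assumes T: "finite T" "0 \<in> T" "m \<in> T" "m \<noteq> 0" and len: "\<And>s xs. xs \<in> \<Gamma> s \<Longrightarrow> length xs = ar s"
  shows "pp_definable UNIV \<Gamma> ar 2 {[h 0, h m] | h. preserves \<Gamma> T h}"
proof -
  \<comment> \<open>The two elements left free must become the variables 0 and 1 of a binary
    relation; the offset 2 keeps all other elements clear of them.\<close>
  define var where "var x = (if x = 0 then 0 else if x = m then 1 else int_encode x + 2)" for x
  have var: "inj var" "var 0 = 0" "var m = 1"
    unfolding var_def inj_def using T(4) by (auto simp: inj_int_encode[THEN inj_eq])
  define X where "X = (SIGMA s:UNIV. {xs \<in> \<Gamma> s. set xs \<subseteq> T})"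
  have "X \<subseteq> (SIGMA s:UNIV. {xs. set xs \<subseteq> T \<and> length xs = ar s})" unfolding X_def using len by auto
  then have "finite X"
    by (rule finite_subset) (use T in \<open>auto intro!: finite_SigmaI finite_lists_length_eq\<close>)
  define \<Phi> where "\<Phi> = (\<lambda>(s, xs). Atom s (map var xs)) ` X"
  have "finite \<Phi>" unfolding \<Phi>_def using \<open>finite X\<close> by simp
  moreover have "is_pp p \<and> wf_fm ar p" if "p \<in> \<Phi>" for p using that len unfolding \<Phi>_def X_def by auto
  ultimately obtain q where q: "is_pp q" "wf_fm ar q" "fv q \<subseteq> {0} \<union> (\<Union>p\<in>\<Phi>. fv p)"
    "\<And>v. sat UNIV \<Gamma> q v \<longleftrightarrow> (\<forall>p\<in>\<Phi>. sat UNIV \<Gamma> p v)" using pp_conj[of \<Phi> ar UNIV \<Gamma>] by blast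
  have fvq: "fv q \<subseteq> var ` T"
  proof -
    have "fv p \<subseteq> var ` T" if "p \<in> \<Phi>" for p using that unfolding \<Phi>_def X_def by fastforce
    moreover have "0 \<in> var ` T" using T var by force
    ultimately show ?thesis using q(3) by blast
  qed
  define V where "V = var ` T - {0, 1}"
  have satq: "sat UNIV \<Gamma> q w \<longleftrightarrow> preserves \<Gamma> T (\<lambda>x. w (var x))" for w
    unfolding q(4) \<Phi>_def X_def preserves_def by (auto simp: comp_def)
  have "finite V" unfolding V_def using T by simp
  from pp_exists[OF this q(1,2), of \<Gamma>] obtain r where r: "is_pp r" "wf_fm ar r" "fv r = fv q - V"
    "\<And>v. sat UNIV \<Gamma> r v \<longleftrightarrow> (\<exists>w. (\<forall>i. i \<notin> V \<longrightarrow> w i = v i) \<and> sat UNIV \<Gamma> q w)" by blast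
  have fvr: "fv r \<subseteq> {..<2}" using r(3) fvq unfolding V_def by auto
  have satr: "sat UNIV \<Gamma> r v \<longleftrightarrow> (\<exists>h. preserves \<Gamma> T h \<and> h 0 = v 0 \<and> h m = v 1)" for v
  proof
    assume "sat UNIV \<Gamma> r v"
    then obtain w where w: "\<forall>i. i \<notin> V \<longrightarrow> w i = v i" "preserves \<Gamma> T (\<lambda>x. w (var x))" using r(4) satq by blast
    then show "\<exists>h. preserves \<Gamma> T h \<and> h 0 = v 0 \<and> h m = v 1"
      using var by (intro exI[of _ "\<lambda>x. w (var x)"]) (auto simp: V_def)
  next
    assume "\<exists>h. preserves \<Gamma> T h \<and> h 0 = v 0 \<and> h m = v 1"
    then obtain h where h: "preserves \<Gamma> T h" "h 0 = v 0" "h m = v 1" by blast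
    define w where "w i = (if i \<in> var ` T then h (inv var i) else v i)" for i
    have wv: "w (var x) = h x" if "x \<in> T" for x unfolding w_def using that var(1) by simp
    have "preserves \<Gamma> T (\<lambda>x. w (var x))"
      unfolding preserves_def
    proof (intro allI impI)
      fix s xs assume xs: "xs \<in> \<Gamma> s" "set xs \<subseteq> T"
      then have eq: "map (\<lambda>x. w (var x)) xs = map h xs" using wv by auto
      show "map (\<lambda>x. w (var x)) xs \<in> \<Gamma> s"
        unfolding eq using h(1) xs unfolding preserves_def by blast
    qed
    moreover have "w i = v i" if "i \<notin> V" for i
    proof (cases "i \<in> var ` T")
      case True
      then have "i = 0 \<or> i = 1" using that unfolding V_def by auto
      then show ?thesis using wv[OF T(2)] wv[OF T(3)] var(2,3) h(2,3) by auto
    qed (simp add: w_def)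
    ultimately show "sat UNIV \<Gamma> r v" using r(4) satq by blast
  qed
  have "{[h 0, h m] | h. preserves \<Gamma> T h} = defined_by UNIV \<Gamma> 2 r"
  proof (intro set_eqI)
    fix xs :: "int list"
    have "xs \<in> defined_by UNIV \<Gamma> 2 r \<longleftrightarrow> length xs = 2 \<and> (\<exists>h. preserves \<Gamma> T h \<and> h 0 = xs ! 0 \<and> h m = xs ! 1)"
      using mem_defined_by_UNIV[OF fvr] satr by blast
    also have "\<dots> \<longleftrightarrow> xs \<in> {[h 0, h m] | h. preserves \<Gamma> T h}"
      by (auto simp: length_Suc_conv numeral_2_eq_2)
    finally show "xs \<in> {[h 0, h m] | h. preserves \<Gamma> T h} \<longleftrightarrow> xs \<in> defined_by UNIV \<Gamma> 2 r" by blast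
  qed
  then show ?thesis unfolding pp_definable_def using r fvr by blast
qed

section \<open>The structures for the four cases\<close>

lemma partial_homs_preserves:
  assumes "threshold N \<Gamma>"
  shows "partial_homs (preserves \<Gamma>) N"
proof
  show "0 \<le> N" using assms threshold_def by blast
next
  fix S h g assume h: "preserves \<Gamma> S h" "preserves \<Gamma> (h ` S) g"
  show "preserves \<Gamma> S (\<lambda>x. g (h x))"
    unfolding preserves_def
  proof (intro allI impI)
    fix s xs assume xs: "xs \<in> \<Gamma> s" "set xs \<subseteq> S"
    then have "map h xs \<in> \<Gamma> s" "set (map h xs) \<subseteq> h ` S" using h(1) unfolding preserves_def by auto
    then have "map g (map h xs) \<in> \<Gamma> s" using h(2) unfolding preserves_def by blast
    then show "map (\<lambda>x. g (h x)) xs \<in> \<Gamma> s" by (simp add: comp_def)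
  qed
next
  fix S h h' assume h: "preserves \<Gamma> S h" "\<And>x y. x \<in> S \<Longrightarrow> y \<in> S \<Longrightarrow> capeq N (h x - h y) (h' x - h' y)"
  show "preserves \<Gamma> S h'"
    unfolding preserves_def
  proof (intro allI impI)
    fix s xs assume xs: "xs \<in> \<Gamma> s" "set xs \<subseteq> S"
    then have "map h xs \<in> \<Gamma> s" using h(1) unfolding preserves_def by blast
    then show "map h' xs \<in> \<Gamma> s" by (rule thresholdD[OF assms]) (use xs h(2) in blast)
  qed
qed (auto simp: preserves_def)

lemma same_csp_finite:
  fixes \<Gamma> :: "'s \<Rightarrow> int list set"
  assumes len: "\<And>s xs. xs \<in> \<Gamma> s \<Longrightarrow> length xs = ar s"
    and B: "\<And>S. finite S \<Longrightarrow> \<exists>h. preserves \<Gamma> S h \<and> h ` S \<subseteq> {0..B}"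
  shows "\<exists>(D :: nat set) (\<Delta> :: 's \<Rightarrow> nat list set).
            finite D \<and> wf_structure ar D \<Delta> \<and> same_csp ar UNIV \<Gamma> D \<Delta>"
proof -
  define D where "D = {..nat B}"
  define \<Delta> where "\<Delta> s = {xs. map int xs \<in> \<Gamma> s \<and> set xs \<subseteq> D}" for s
  have "wf_structure ar D \<Delta>" unfolding wf_structure_def \<Delta>_def D_def using len by force
  moreover have "same_csp ar UNIV \<Gamma> D \<Delta>"
    unfolding same_csp_def
  proof (intro allI impI iffI)
    fix p assume p: "pp_sentence ar p" "holds UNIV \<Gamma> p"
    show "holds D \<Delta> p"
    proof (rule holds_transfer[OF p])
      fix W :: "int set" assume "finite W"
      then obtain h where h: "preserves \<Gamma> W h" "h ` W \<subseteq> {0..B}" using B by blast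
      have nn: "0 \<le> h x" "h x \<le> B" if "x \<in> W" for x using h(2) that by auto
      show "\<exists>h. h ` W \<subseteq> D \<and> (\<forall>s xs. xs \<in> \<Gamma> s \<longrightarrow> set xs \<subseteq> W \<longrightarrow> map h xs \<in> \<Delta> s)"
      proof (intro exI[of _ "\<lambda>x. nat (h x)"] conjI allI impI)
        show W: "(\<lambda>x. nat (h x)) ` W \<subseteq> D" unfolding D_def using nn by (auto intro!: nat_mono)
        fix s xs assume xs: "xs \<in> \<Gamma> s" "set xs \<subseteq> W"
        then have "map int (map (\<lambda>x. nat (h x)) xs) = map h xs" using nn by auto
        moreover have "map h xs \<in> \<Gamma> s" using h(1) xs unfolding preserves_def by blast
        moreover have "set (map (\<lambda>x. nat (h x)) xs) \<subseteq> D" using W xs(2) by auto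
        ultimately show "map (\<lambda>x. nat (h x)) xs \<in> \<Delta> s" unfolding \<Delta>_def by (simp del: map_map)
      qed
    qed simp
  next
    fix p assume p: "pp_sentence ar p" "holds D \<Delta> p"
    show "holds UNIV \<Gamma> p"
      by (rule holds_transfer[OF p]) (auto simp: D_def \<Delta>_def intro!: exI[of _ int])
  qed
  ultimately show ?thesis unfolding D_def by blast
qed

text \<open>\<Delta> consists of the order types of tuples of \<Gamma> whose distinct entries are
  more than \<open>N\<close> apart. Spread tuples of \<Gamma> therefore enter \<Delta>, and a tuple
  of \<Delta> enters \<Gamma> once its order type is realised with gaps above \<open>N\<close>, for
  which \<open>N + 1\<close> times the rank will do.\<close>

lemma same_csp_rat:
  fixes \<Gamma> :: "'s \<Rightarrow> int list set"
  assumes N: "threshold N \<Gamma>" and len: "\<And>s xs. xs \<in> \<Gamma> s \<Longrightarrow> length xs = ar s"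
    and sp: "\<And>S. finite S \<Longrightarrow> \<exists>h. preserves \<Gamma> S h \<and> (\<forall>x\<in>S. \<forall>y\<in>S. h x = h y \<or> N < \<bar>h x - h y\<bar>)"
  shows "\<exists>\<Delta> :: 's \<Rightarrow> rat list set. order_reduct ar \<Delta> \<and> same_csp ar UNIV \<Gamma> UNIV \<Delta>"
proof -
  have N0: "0 \<le> N" using N threshold_def by blast
  define \<Delta> :: "'s \<Rightarrow> rat list set" where
    "\<Delta> s = {xs. \<exists>ys\<in>\<Gamma> s. length xs = length ys \<and> (\<forall>i<length ys. \<forall>j<length ys.
       (ys ! i = ys ! j \<or> N < \<bar>ys ! i - ys ! j\<bar>) \<and> (xs ! i < xs ! j \<longleftrightarrow> ys ! i < ys ! j))}" for s
  have "order_reduct ar \<Delta>"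
    unfolding order_reduct_def
  proof
    fix s
    define T where "T = (\<lambda>(i, j). Atom () [i, j]) ` ({..<ar s} \<times> {..<ar s})"
    show "fo_definable UNIV lt_rel lt_ar (ar s) (\<Delta> s)"
    proof (rule fo_definable_of_tests[of T])
      fix xs zs :: "rat list" assume xs: "xs \<in> \<Delta> s" and zs: "length zs = ar s" and
        tests: "\<And>p. p \<in> T \<Longrightarrow> sat UNIV lt_rel p (\<lambda>i. xs ! i) = sat UNIV lt_rel p (\<lambda>i. zs ! i)"
      have eq: "xs ! i < xs ! j \<longleftrightarrow> zs ! i < zs ! j" if "i < ar s" "j < ar s" for i j
      proof -
        have "Atom () [i, j] \<in> T" unfolding T_def using that by auto
        from tests[OF this] show ?thesis by simp
      qed
      obtain ys where ys: "ys \<in> \<Gamma> s" "length xs = length ys" "\<forall>i<length ys. \<forall>j<length ys.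
         (ys ! i = ys ! j \<or> N < \<bar>ys ! i - ys ! j\<bar>) \<and> (xs ! i < xs ! j \<longleftrightarrow> ys ! i < ys ! j)"
        using xs unfolding \<Delta>_def by blast
      then show "zs \<in> \<Delta> s" unfolding \<Delta>_def using zs len[OF ys(1)] eq
        by (intro CollectI bexI[OF _ ys(1)]) simp
    qed (auto simp: T_def lt_ar_def \<Delta>_def len)
  qed
  moreover have "same_csp ar UNIV \<Gamma> UNIV \<Delta>"
    unfolding same_csp_def
  proof (intro allI impI iffI)
    fix p assume p: "pp_sentence ar p" "holds UNIV \<Gamma> p"
    show "holds UNIV \<Delta> p"
    proof (rule holds_transfer[OF p])
      fix W :: "int set" assume "finite W"
      then obtain h where h: "preserves \<Gamma> W h" "\<forall>x\<in>W. \<forall>y\<in>W. h x = h y \<or> N < \<bar>h x - h y\<bar>" using sp by blast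
      show "\<exists>h. h ` W \<subseteq> UNIV \<and> (\<forall>s xs. xs \<in> \<Gamma> s \<longrightarrow> set xs \<subseteq> W \<longrightarrow> map h xs \<in> \<Delta> s)"
      proof (intro exI[of _ "\<lambda>x. of_int (h x)"] conjI allI impI)
        fix s xs assume xs: "xs \<in> \<Gamma> s" "set xs \<subseteq> W"
        then have "map h xs \<in> \<Gamma> s" using h(1) unfolding preserves_def by blast
        moreover have "xs ! i \<in> W" if "i < length xs" for i using xs that by auto
        ultimately show "map (\<lambda>x. of_int (h x)) xs \<in> \<Delta> s" unfolding \<Delta>_def using h(2)
          by (intro CollectI bexI[of _ "map h xs"]) auto
      qed simp
    qed simp
  next
    fix p assume p: "pp_sentence ar p" "holds UNIV \<Delta> p"
    show "holds UNIV \<Gamma> p"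
    proof (rule holds_transfer[OF p])
      fix W :: "rat set" assume W: "finite W"
      define h where "h x = (N + 1) * int (card {y \<in> W. y < x})" for x
      have mono: "h y - h x > N" if "x \<in> W" "x < y" for x y
      proof -
        have "card {z \<in> W. z < x} < card {z \<in> W. z < y}"
          by (rule psubset_card_mono) (use W that in auto)
        then have "(N + 1) * (int (card {z \<in> W. z < x}) + 1) \<le> (N + 1) * int (card {z \<in> W. z < y})"
          using N0 by (intro mult_left_mono) auto
        then show ?thesis unfolding h_def by (simp add: algebra_simps)
      qed
      show "\<exists>h. h ` W \<subseteq> UNIV \<and> (\<forall>s xs. xs \<in> \<Delta> s \<longrightarrow> set xs \<subseteq> W \<longrightarrow> map h xs \<in> \<Gamma> s)"
      proof (intro exI[of _ h] conjI allI impI)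
        fix s xs assume xs: "xs \<in> \<Delta> s" "set xs \<subseteq> W"
        obtain ys where ys: "ys \<in> \<Gamma> s" "length xs = length ys" and o: "\<And>i j. i < length ys \<Longrightarrow> j < length ys \<Longrightarrow>
         (ys ! i = ys ! j \<or> N < \<bar>ys ! i - ys ! j\<bar>) \<and> (xs ! i < xs ! j \<longleftrightarrow> ys ! i < ys ! j)"
          using xs(1) unfolding \<Delta>_def by blast
        have xW: "xs ! i \<in> W" if "i < length ys" for i using xs(2) ys(2) that by auto
        have "capeq N (ys ! i - ys ! j) (map h xs ! i - map h xs ! j)" if ij: "i < length ys" "j < length ys" for i j
        proof -
          have e: "map h xs ! i = h (xs ! i)" "map h xs ! j = h (xs ! j)" using ij ys(2) by simp_all
          consider "xs ! i < xs ! j" | "xs ! j < xs ! i" | "xs ! i = xs ! j" by (meson linorder_less_linear)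
          then show ?thesis
          proof cases
            case 1
            then show ?thesis using mono[OF xW[OF ij(1)] 1] o[OF ij] unfolding e capeq_def by auto
          next
            case 2
            then show ?thesis using mono[OF xW[OF ij(2)] 2] o[OF ij(2,1)] unfolding e capeq_def by auto
          next
            case 3
            then have "ys ! i = ys ! j" using o[OF ij] o[OF ij(2,1)] by auto
            then show ?thesis using 3 unfolding e capeq_def by simp
          qed
        qed
        then show "map h xs \<in> \<Gamma> s" using N ys unfolding threshold_def by (metis length_map)
      qed simp
    qed simp
  qed
  ultimately show ?thesis by blast
qed

section \<open>Restriction to the multiples of g\<close>

text \<open>The second structure is \<Gamma> restricted to the multiples of \<open>g\<close>,
  renamed along \<open>x \<mapsto> g * x\<close> so that its domain is all of \<open>int\<close>.
  That renaming transfers sentences one way, the maps from \<open>sc\<close> the other way.\<close>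

lemma same_csp_scaled:
  fixes \<Gamma> :: "'s \<Rightarrow> int list set"
  assumes g: "1 \<le> g" and sc: "\<And>S. finite S \<Longrightarrow> \<exists>h. preserves \<Gamma> S h \<and> (\<forall>x\<in>S. g dvd h x)"
  shows "same_csp ar UNIV \<Gamma> UNIV (\<lambda>s. {xs. map ((*) g) xs \<in> \<Gamma> s})"
  unfolding same_csp_def
proof (intro allI impI iffI)
  fix p assume p: "pp_sentence ar p" "holds UNIV \<Gamma> p"
  show "holds UNIV (\<lambda>s. {xs. map ((*) g) xs \<in> \<Gamma> s}) p"
  proof (rule holds_transfer[OF p])
    fix W :: "int set" assume "finite W"
    then obtain h where h: "preserves \<Gamma> W h" "\<forall>x\<in>W. g dvd h x" using sc by blast
    have "map ((*) g) (map (\<lambda>x. h x div g) xs) \<in> \<Gamma> s" if "xs \<in> \<Gamma> s" "set xs \<subseteq> W" for s xs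
    proof -
      have "map ((*) g) (map (\<lambda>x. h x div g) xs) = map h xs" using h(2) that(2) by auto
      then show ?thesis using h(1) that unfolding preserves_def by metis
    qed
    then show "\<exists>h. h ` W \<subseteq> UNIV \<and> (\<forall>s xs. xs \<in> \<Gamma> s \<longrightarrow> set xs \<subseteq> W \<longrightarrow> map h xs \<in> {xs. map ((*) g) xs \<in> \<Gamma> s})"
      by (intro exI[of _ "\<lambda>x. h x div g"]) blast
  qed simp
next
  fix p assume p: "pp_sentence ar p" "holds UNIV (\<lambda>s. {xs. map ((*) g) xs \<in> \<Gamma> s}) p"
  show "holds UNIV \<Gamma> p" by (rule holds_transfer[OF p]) (auto intro!: exI[of _ "(*) g"])
qed

lemma threshold_scaled:
  assumes g: "1 \<le> g" and N: "threshold N \<Gamma>"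
  shows "threshold N (\<lambda>s. {xs. map ((*) g) xs \<in> \<Gamma> s})"
proof -
  have N0: "0 \<le> N" using N threshold_def by blast
  have cap: "capeq N (g * a - g * b) (g * a' - g * b')" if "capeq N (a - b) (a' - b')" for a b a' b'
  proof -
    have *: "N < g * x" if "N < x" for x
    proof -
      have "1 * x \<le> g * x" using g that N0 by (intro mult_right_mono) auto
      then show ?thesis using that by simp
    qed
    have "capeq N (g * x) (g * y)" if "capeq N x y" for x y
      using that *[of x] *[of y] *[of "- x"] *[of "- y"] unfolding capeq_def by auto
    from this[OF that] show ?thesis by (simp add: right_diff_distrib)
  qed
  show ?thesis
    unfolding threshold_def
  proof (intro conjI allI impI)
    fix s and xs ys :: "int list" assume len: "length xs = length ys"
      and c: "\<forall>i<length xs. \<forall>j<length xs. capeq N (xs ! i - xs ! j) (ys ! i - ys ! j)"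
      and mem: "xs \<in> {xs. map ((*) g) xs \<in> \<Gamma> s}"
    have "\<forall>i<length (map ((*) g) xs). \<forall>j<length (map ((*) g) xs).
       capeq N (map ((*) g) xs ! i - map ((*) g) xs ! j) (map ((*) g) ys ! i - map ((*) g) ys ! j)"
      using c cap len by simp
    then show "ys \<in> {xs. map ((*) g) xs \<in> \<Gamma> s}" using N mem len unfolding threshold_def
      by (metis length_map mem_Collect_eq)
  qed (rule N0)
qed

text \<open>The finite set \<open>T\<close> that freezes \<open>m * g\<close> in \<Gamma> need not
  consist of multiples of \<open>g\<close>. So it is first moved there by some \<open>p\<close>,
  which keeps the pair at distance \<open>m * g\<close>. A map \<open>h\<close> of the scaled
  structure then induces \<open>x \<mapsto> g * h (p x div g)\<close> on \<open>T\<close>, to which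
  the freezing applies.\<close>

lemma frozen_scaled:
  fixes \<Gamma> :: "'s \<Rightarrow> int list set"
  assumes N: "threshold N \<Gamma>" and g: "1 \<le> g"
    and sc: "\<And>S. finite S \<Longrightarrow> \<exists>h. preserves \<Gamma> S h \<and> (\<forall>x\<in>S. g dvd h x)"
    and fr: "\<forall>\<^sub>F h in partial_homs.homs (preserves \<Gamma>). \<bar>h (m * g) - h 0\<bar> = m * g"
    and m: "0 \<le> m"
  shows "\<forall>\<^sub>F h in partial_homs.homs (preserves (\<lambda>s. {xs. map ((*) g) xs \<in> \<Gamma> s})). \<bar>h m - h 0\<bar> = m"
proof -
  let ?\<Delta> = "\<lambda>s. {xs. map ((*) g) xs \<in> \<Gamma> s}"
  interpret A: partial_homs "preserves \<Gamma>" N by (rule partial_homs_preserves[OF N])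
  interpret B: partial_homs "preserves ?\<Delta>" N
    by (rule partial_homs_preserves[OF threshold_scaled[OF g N]])
  obtain S where S: "finite S" "\<And>h. preserves \<Gamma> S h \<Longrightarrow> \<bar>h (m * g) - h 0\<bar> = m * g"
    using fr unfolding A.eventually_homs by blast
  define T where "T = insert 0 (insert (m * g) S)"
  have T: "finite T" "0 \<in> T" "m * g \<in> T" unfolding T_def using S(1) by auto
  have frT: "\<bar>h (m * g) - h 0\<bar> = m * g" if "preserves \<Gamma> T h" for h
    by (rule S(2)[OF A.hom_mono[OF that]]) (auto simp: T_def)
  obtain p where p: "preserves \<Gamma> T p" "\<And>x. x \<in> T \<Longrightarrow> g dvd p x" using sc[OF T(1)] by blast
  define U where "U = (\<lambda>x. p x div g) ` T"
  have "\<bar>h (p (m * g) div g) - h (p 0 div g)\<bar> = m" if h: "preserves ?\<Delta> U h" for h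
  proof -
    have "preserves \<Gamma> T (\<lambda>x. g * h (p x div g))"
      unfolding preserves_def
    proof (intro allI impI)
      fix s xs assume xs: "xs \<in> \<Gamma> s" "set xs \<subseteq> T"
      have "map ((*) g) (map (\<lambda>x. p x div g) xs) = map p xs" using p(2) xs(2) by auto
      moreover have "map p xs \<in> \<Gamma> s" using p(1) xs unfolding preserves_def by blast
      ultimately have "map (\<lambda>x. p x div g) xs \<in> ?\<Delta> s" by (metis mem_Collect_eq)
      moreover have "set (map (\<lambda>x. p x div g) xs) \<subseteq> U" unfolding U_def using xs(2) by auto
      ultimately have "map h (map (\<lambda>x. p x div g) xs) \<in> ?\<Delta> s" using h unfolding preserves_def by blast
      then show "map (\<lambda>x. g * h (p x div g)) xs \<in> \<Gamma> s" by (simp add: comp_def)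
    qed
    from frT[OF this] have "\<bar>g * (h (p (m * g) div g) - h (p 0 div g))\<bar> = g * m"
      by (simp add: right_diff_distrib mult.commute)
    then show ?thesis using g by (simp add: abs_mult)
  qed
  then have ev: "\<forall>\<^sub>F h in B.homs. \<bar>h (p (m * g) div g) - h (p 0 div g)\<bar> = m"
    unfolding B.eventually_homs using T(1) by (intro exI[of _ U]) (simp add: U_def)
  have pd: "\<bar>p (m * g) div g - p 0 div g\<bar> = m"
  proof -
    obtain a b where ab: "p (m * g) = g * a" "p 0 = g * b" using p(2) T(2,3) unfolding dvd_def by blast
    have "g * \<bar>a - b\<bar> = \<bar>g * a - g * b\<bar>" using g by (simp add: abs_mult flip: right_diff_distrib)
    also have "\<dots> = g * m" using frT[OF p(1)] unfolding ab by (simp add: mult.commute)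
    finally have "\<bar>a - b\<bar> = m" using g by simp
    then show ?thesis using g unfolding ab by simp
  qed
  define u v where "u = p (m * g) div g" and "v = p 0 div g"
  have "\<forall>\<^sub>F h in B.homs. \<bar>h (u - v + 0) - h (0 + 0)\<bar> = m"
  proof -
    have "\<forall>\<^sub>F h in B.homs. \<bar>h (u + - v) - h (v + - v)\<bar> = m"
      using B.eventually_shift[OF ev[folded u_def v_def], of "- v"] .
    then show ?thesis by simp
  qed
  then have "\<forall>\<^sub>F h in B.homs. \<bar>h (u - v) - h 0\<bar> = m" by simp
  from B.eventually_pair[where P="\<lambda>z. z = m", OF this, of m 0] show ?thesis
    using pd m unfolding u_def v_def by simp
qed

text \<open>Freezing makes the relation defined by a diagram small enough. It is large enough
  because translations preserve the relations, and so do reflections if \<open>uminus\<close>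
  preserves every finite set; otherwise the pair \<open>0, 1\<close> keeps its orientation and
  translations suffice for \<open>suc_rel\<close>.\<close>

lemma pp_definable_frozen:
  fixes \<Gamma> :: "'s::finite \<Rightarrow> int list set"
  assumes N: "threshold N \<Gamma>" and len: "\<And>s xs. xs \<in> \<Gamma> s \<Longrightarrow> length xs = ar s"
    and fr: "\<And>m. 0 \<le> m \<Longrightarrow> \<forall>\<^sub>F h in partial_homs.homs (preserves \<Gamma>). \<bar>h m - h 0\<bar> = m"
  shows "(\<forall>k\<ge>1. pp_definable UNIV \<Gamma> ar 2 (Dist k)) \<or> pp_definable UNIV \<Gamma> ar 2 suc_rel"
proof -
  interpret partial_homs "preserves \<Gamma>" N by (rule partial_homs_preserves[OF N])
  have ctx: "\<exists>T. finite T \<and> 0 \<in> T \<and> m \<in> T \<and> (\<forall>h. preserves \<Gamma> T h \<longrightarrow> P h)"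
    if "\<forall>\<^sub>F h in homs. P h" for P :: "(int \<Rightarrow> int) \<Rightarrow> bool" and m
  proof -
    from that[unfolded eventually_homs] obtain S where
      S: "finite S" "\<forall>h. preserves \<Gamma> S h \<longrightarrow> P h" by (elim exE conjE)
    have "P h" if "preserves \<Gamma> (insert 0 (insert m S)) h" for h
      using S(2) hom_mono[OF that, of S] by blast
    then show ?thesis using S(1) by (intro exI[of _ "insert 0 (insert m S)"]) simp
  qed
  have trans: "preserves \<Gamma> S (\<lambda>x. x + a)" for S a
    by (rule hom_capeq[OF hom_id]) (auto simp: capeq_def)
  show ?thesis
  proof (cases "\<forall>S. finite S \<longrightarrow> preserves \<Gamma> S uminus")
    case True
    have "pp_definable UNIV \<Gamma> ar 2 (Dist k)" if k: "1 \<le> k" for k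
    proof -
      have "\<forall>\<^sub>F h in homs. \<bar>h k - h 0\<bar> = k" by (rule fr) (use k in simp)
      from ctx[OF this, of k] obtain T where
        T: "finite T" "0 \<in> T" "k \<in> T" "\<And>h. preserves \<Gamma> T h \<Longrightarrow> \<bar>h k - h 0\<bar> = k" by blast
      have flip: "preserves \<Gamma> T (\<lambda>x. - x + a)" for a
        using hom_comp[of T uminus "\<lambda>x. x + a"] True T(1) trans by blast
      have "{[h 0, h k] | h. preserves \<Gamma> T h} = Dist k"
      proof (intro equalityI subsetI)
        fix xs assume "xs \<in> {[h 0, h k] | h. preserves \<Gamma> T h}"
        then obtain h where h: "xs = [h 0, h k]" "preserves \<Gamma> T h" by blast
        then show "xs \<in> Dist k" unfolding Dist_def using T(4)[OF h(2)] by (auto simp: abs_minus_commute)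
      next
        fix xs assume "xs \<in> Dist k"
        then obtain x y where xy: "xs = [x, y]" "\<bar>x - y\<bar> = k" unfolding Dist_def by blast
        then consider "y = x + k" | "y = x - k" by linarith
        then show "xs \<in> {[h 0, h k] | h. preserves \<Gamma> T h}"
        proof cases
          case 1
          then show ?thesis using trans[of T x] xy(1) by (intro CollectI exI[of _ "\<lambda>z. z + x"]) simp
        next
          case 2
          then show ?thesis using flip[of x] xy(1) by (intro CollectI exI[of _ "\<lambda>z. - z + x"]) simp
        qed
      qed
      moreover have "k \<noteq> 0" using k by simp
      ultimately show ?thesis
        using pp_definable_preserves[where \<Gamma>=\<Gamma> and ar=ar, OF T(1,2,3) _ len] by metis
    qed
    then show ?thesis by blast
  next
    case False
    then obtain S where "finite S" "\<not> preserves \<Gamma> S uminus" by blast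
    from ctx[OF frozen_orientation[OF fr this], of 1] obtain T where
      T: "finite T" "0 \<in> T" "1 \<in> T" "\<And>h. preserves \<Gamma> T h \<Longrightarrow> h 1 = h 0 + 1" by blast
    have "{[h 0, h 1] | h. preserves \<Gamma> T h} = suc_rel"
    proof (intro equalityI subsetI)
      fix xs assume "xs \<in> {[h 0, h 1] | h. preserves \<Gamma> T h}"
      then show "xs \<in> suc_rel" unfolding suc_rel_def using T(4) by auto
    next
      fix xs assume "xs \<in> suc_rel"
      then obtain x where "xs = [x, x + 1]" unfolding suc_rel_def by blast
      then show "xs \<in> {[h 0, h 1] | h. preserves \<Gamma> T h}"
        using trans[of T x] by (intro CollectI exI[of _ "\<lambda>z. z + x"]) simp
    qed
    then show ?thesis
      using pp_definable_preserves[where \<Gamma>=\<Gamma> and ar=ar, OF T(1,2,3) one_neq_zero len] by simp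
  qed
qed

theorem mainTheorem4:
  fixes ar :: "'s::finite \<Rightarrow> nat" and \<Gamma> :: "'s \<Rightarrow> int list set"
  assumes "order_reduct ar \<Gamma>"
  shows "(\<exists>(D :: nat set) (\<Delta> :: 's \<Rightarrow> nat list set).
            finite D \<and> wf_structure ar D \<Delta> \<and> same_csp ar UNIV \<Gamma> D \<Delta>)
       \<or> (\<exists>\<Delta> :: 's \<Rightarrow> rat list set.
            order_reduct ar \<Delta> \<and> same_csp ar UNIV \<Gamma> UNIV \<Delta>)
       \<or> (\<exists>\<Delta> :: 's \<Rightarrow> int list set.
            order_reduct ar \<Delta> \<and> (\<forall>k::int. k \<ge> 1 \<longrightarrow> pp_definable UNIV \<Delta> ar 2 (Dist k))
            \<and> same_csp ar UNIV \<Gamma> UNIV \<Delta>)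
       \<or> (\<exists>\<Delta> :: 's \<Rightarrow> int list set.
            order_reduct ar \<Delta> \<and> pp_definable UNIV \<Delta> ar 2 suc_rel
            \<and> same_csp ar UNIV \<Gamma> UNIV \<Delta>)"
proof -
  obtain N where N: "threshold N \<Gamma>" using order_reduct_threshold[OF assms] by blast
  note len = order_reduct_length[OF assms]
  interpret partial_homs "preserves \<Gamma>" N by (rule partial_homs_preserves[OF N])
  from trichotomy show ?thesis
  proof (elim disjE)
    assume "\<forall>S. finite S \<longrightarrow> (\<exists>h. preserves \<Gamma> S h \<and> (\<forall>x\<in>S. \<forall>y\<in>S. h x = h y \<or> N < \<bar>h x - h y\<bar>))"
    from same_csp_rat[OF N len this[rule_format]] show ?thesis by (intro disjI2[OF disjI1])
  next
    assume "\<exists>B. \<forall>S. finite S \<longrightarrow> (\<exists>h. preserves \<Gamma> S h \<and> h ` S \<subseteq> {0..B})"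
    then obtain B where "\<forall>S. finite S \<longrightarrow> (\<exists>h. preserves \<Gamma> S h \<and> h ` S \<subseteq> {0..B})" ..
    from same_csp_finite[OF len this[rule_format]] show ?thesis by (rule disjI1)
  next
    assume "\<exists>g\<ge>1. (\<forall>S. finite S \<longrightarrow> (\<exists>h. preserves \<Gamma> S h \<and> (\<forall>x\<in>S. g dvd h x))) \<and>
      (\<forall>m\<ge>0. \<forall>\<^sub>F h in homs. \<bar>h (m * g) - h 0\<bar> = m * g)"
    then obtain g where g: "1 \<le> g"
      and "\<forall>S. finite S \<longrightarrow> (\<exists>h. preserves \<Gamma> S h \<and> (\<forall>x\<in>S. g dvd h x))"
      and "\<forall>m\<ge>0. \<forall>\<^sub>F h in homs. \<bar>h (m * g) - h 0\<bar> = m * g" by (elim exE conjE)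
    note scaled = g this(2,3)[rule_format]
    define \<Delta> where "\<Delta> = (\<lambda>s. {xs. map ((*) g) xs \<in> \<Gamma> s})"
    have th: "threshold N \<Delta>" unfolding \<Delta>_def by (rule threshold_scaled[OF scaled(1) N])
    have len': "length xs = ar s" if "xs \<in> \<Delta> s" for s xs
      using that len[of "map ((*) g) xs" s] unfolding \<Delta>_def by simp
    have "order_reduct ar \<Delta>" by (rule threshold_order_reduct[OF th len'])
    moreover have "same_csp ar UNIV \<Gamma> UNIV \<Delta>"
      unfolding \<Delta>_def by (rule same_csp_scaled[OF scaled(1,2)])
    moreover have "\<forall>\<^sub>F h in partial_homs.homs (preserves \<Delta>). \<bar>h m - h 0\<bar> = m" if "0 \<le> m" for m
      unfolding \<Delta>_def by (rule frozen_scaled[OF N scaled(1,2) scaled(3)[OF that] that])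
    from pp_definable_frozen[OF th len' this]
    have "(\<forall>k\<ge>1. pp_definable UNIV \<Delta> ar 2 (Dist k)) \<or> pp_definable UNIV \<Delta> ar 2 suc_rel" .
    ultimately show ?thesis by blast
  qed
qed

end
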